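(* The class of $f\mathrm{SC}_\kappa$-spaces is closed under $G^\kappa_\delta$ subspaces, under sums of at most $\kappa$-many spaces, and under products of at most $\kappa$-many spaces (where products carry the ${<}\kappa$-supported product topology).
   Context: Work in ZFC; $\kappa$ is an uncountable regular cardinal with $2^{<\kappa}=\kappa$ (equivalently $\kappa^{<\kappa}=\kappa$). "Space" means regular Hausdorff topological space. A $G^\kappa_\delta$ subset of a space is an intersection of $\kappa$-many open sets (repetitions allowed). Sums are disjoint topological sums. The ${<}\kappa$-supported product topology on $\prod_{i\in I}X_i$ is generated by the sets $\prod_{i\in I}U_i$ with each $U_i$ open in $X_i$ and $U_i\neq X_i$ for fewer than $\kappa$-many $i$. Strong fair $\kappa$-Choquet game $f\mathrm{G}^s_\kappa(X)$: players I and II play $\kappa$-many rounds. In round $\alpha<\kappa$, I plays $(U_\alpha,x_\alpha)$ with $U_\alpha$ a relatively open subset of $\bigcap_{\beta<\alpha}V_\beta$ (which is $X$ if $\alpha=0$) and $x_\alpha\in U_\alpha$; then II plays a relatively open subset $V_\alpha$ of $\bigcap_{\beta<\alpha}V_\beta$ with $x_\alpha\in V_\alpha\subseteq U_\alpha$. If $\bigcap_{\alpha<\gamma}V_\alpha=\emptyset$ for some limit $\gamma<\kappa$, the run ends and II wins. If the run lasts $\kappa$ rounds, II wins iff $\bigcap_{\alpha<\kappa}V_\alpha\neq\emptyset$. $X$ is an $f\mathrm{SC}_\kappa$-space if it has weight $\le\kappa$ and II has a winning strategy in $f\mathrm{G}^s_\kappa(X)$. (The empty space, where I has no legal move, counts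 as such.) *)

theory Defs
  imports "HOL-Analysis.Analysis"
begin

unbundle cardinal_syntax

text \<open>A cardinal is a cardinal order relation \<open>\<kappa>\<close>. The ordinals below \<open>\<kappa>\<close> (in particular the rounds
  of the game) are the elements of \<open>Field \<kappa>\<close>; \<open>underS \<kappa> \<alpha>\<close> is the set of \<open>\<beta> < \<alpha>\<close> and
  \<open>under \<kappa> \<alpha>\<close> the set of \<open>\<beta> \<le> \<alpha>\<close>.\<close>

text \<open>The set of binary sequences of length less than \<open>\<kappa>\<close>, whose cardinality is \<open>2\<^sup><\<^sup>\<kappa>\<close>.\<close>

definition binary_seqs_below :: "'k rel \<Rightarrow> ('k \<rightharpoonup> bool) set" where
  "binary_seqs_below \<kappa> = {s. \<exists>\<alpha>\<in>Field \<kappa>. dom s = underS \<kappa> \<alpha>}"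

definition admissible_cardinal :: "'k rel \<Rightarrow> bool" where
  "admissible_cardinal \<kappa> \<longleftrightarrow>
     Card_order \<kappa> \<and> natLeq <o \<kappa> \<and> regularCard \<kappa> \<and> |binary_seqs_below \<kappa>| =o \<kappa>"

definition weight_le :: "'a topology \<Rightarrow> 'k rel \<Rightarrow> bool" where
  "weight_le X \<kappa> \<longleftrightarrow>
     (\<exists>\<B>. |\<B>| \<le>o \<kappa> \<and> (\<forall>B\<in>\<B>. openin X B) \<and>
          (\<forall>U x. openin X U \<and> x \<in> U \<longrightarrow> (\<exists>B\<in>\<B>. x \<in> B \<and> B \<subseteq> U)))"

definition Gdelta_set :: "'k rel \<Rightarrow> 'a topology \<Rightarrow> 'a set \<Rightarrow> bool" where
  "Gdelta_set \<kappa> X S \<longleftrightarrow>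
     (\<exists>W. (\<forall>\<alpha>\<in>Field \<kappa>. openin X (W \<alpha>)) \<and> S = (\<Inter>\<alpha>\<in>Field \<kappa>. W \<alpha>))"

definition lt_supported_product_topology ::
  "'k rel \<Rightarrow> ('i \<Rightarrow> 'a topology) \<Rightarrow> 'i set \<Rightarrow> ('i \<Rightarrow> 'a) topology" where
  "lt_supported_product_topology \<kappa> X I =
     topology_generated_by
       {PiE I U | U. (\<forall>i\<in>I. openin (X i) (U i)) \<and> |{i\<in>I. U i \<noteq> topspace (X i)}| <o \<kappa>}"

definition limit_round :: "'k rel \<Rightarrow> 'k \<Rightarrow> bool" where
  "limit_round \<kappa> \<gamma> \<longleftrightarrow>
     \<gamma> \<in> Field \<kappa> \<and> underS \<kappa> \<gamma> \<noteq> {} \<and> (\<forall>\<alpha>\<in>underS \<kappa> \<gamma>. \<exists>\<beta>\<in>underS \<kappa> \<gamma>. \<alpha> \<in> underS \<kappa> \<beta>)"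

text \<open>In a run, \<open>m \<alpha>\<close> is the move (an open set and a point) of player I in round \<open>\<alpha>\<close>, and \<open>V \<alpha>\<close> that
  of player II. Both are total functions; what they do after the run has ended is irrelevant.\<close>

definition current_set :: "'k rel \<Rightarrow> 'a topology \<Rightarrow> ('k \<Rightarrow> 'a set) \<Rightarrow> 'k \<Rightarrow> 'a set" where
  "current_set \<kappa> X V \<alpha> = topspace X \<inter> (\<Inter>\<beta>\<in>underS \<kappa> \<alpha>. V \<beta>)"

text \<open>Round \<open>\<alpha>\<close> is reached only if no limit round \<open>\<gamma> \<le> \<alpha>\<close> has ended the run (in favour of II).\<close>

definition round_reached :: "'k rel \<Rightarrow> 'a topology \<Rightarrow> ('k \<Rightarrow> 'a set) \<Rightarrow> 'k \<Rightarrow> bool" where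
  "round_reached \<kappa> X V \<alpha> \<longleftrightarrow>
     (\<forall>\<gamma>\<in>under \<kappa> \<alpha>. limit_round \<kappa> \<gamma> \<longrightarrow> current_set \<kappa> X V \<gamma> \<noteq> {})"

definition legal_I ::
  "'k rel \<Rightarrow> 'a topology \<Rightarrow> ('k \<Rightarrow> 'a set) \<Rightarrow> 'k \<Rightarrow> 'a set \<times> 'a \<Rightarrow> bool" where
  "legal_I \<kappa> X V \<alpha> = (\<lambda>(U, x). openin (subtopology X (current_set \<kappa> X V \<alpha>)) U \<and> x \<in> U)"

definition legal_II ::
  "'k rel \<Rightarrow> 'a topology \<Rightarrow> ('k \<Rightarrow> 'a set) \<Rightarrow> 'k \<Rightarrow> 'a set \<times> 'a \<Rightarrow> 'a set \<Rightarrow> bool" where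
  "legal_II \<kappa> X V \<alpha> = (\<lambda>(U, x) W.
     openin (subtopology X (current_set \<kappa> X V \<alpha>)) W \<and> x \<in> W \<and> W \<subseteq> U)"

text \<open>A strategy of II maps the moves of I up to and including the current round, and the moves of II
  in all previous rounds, to the next move of II.\<close>

type_synonym ('k, 'a) strategy_II = "('k \<rightharpoonup> 'a set \<times> 'a) \<Rightarrow> ('k \<rightharpoonup> 'a set) \<Rightarrow> 'a set"

definition follows_strategy ::
  "'k rel \<Rightarrow> ('k, 'a) strategy_II \<Rightarrow> ('k \<Rightarrow> 'a set \<times> 'a) \<Rightarrow> ('k \<Rightarrow> 'a set) \<Rightarrow> 'k \<Rightarrow> bool" where
  "follows_strategy \<kappa> \<sigma> m V \<alpha> \<longleftrightarrow>
     V \<alpha> = \<sigma> ((Some \<circ> m) |` under \<kappa> \<alpha>) ((Some \<circ> V) |` underS \<kappa> \<alpha>)"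

definition played_round ::
  "'k rel \<Rightarrow> 'a topology \<Rightarrow> ('k, 'a) strategy_II \<Rightarrow> ('k \<Rightarrow> 'a set \<times> 'a) \<Rightarrow> ('k \<Rightarrow> 'a set) \<Rightarrow> 'k \<Rightarrow> bool"
  where
  "played_round \<kappa> X \<sigma> m V \<alpha> \<longleftrightarrow>
     round_reached \<kappa> X V \<alpha> \<and> legal_I \<kappa> X V \<alpha> (m \<alpha>) \<and> follows_strategy \<kappa> \<sigma> m V \<alpha>"

text \<open>A winning strategy answers every legal move of I legally, and wins every run that lasts \<open>\<kappa>\<close>
  rounds. Runs that end earlier, at a limit round with empty intersection, are won by II and so
  impose no further condition; the same holds if the space is empty, where I has no first move.\<close>

definition winning_strategy_II :: "'k rel \<Rightarrow> 'a topology \<Rightarrow> ('k, 'a) strategy_II \<Rightarrow> bool" where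
  "winning_strategy_II \<kappa> X \<sigma> \<longleftrightarrow>
     (\<forall>m V.
        (\<forall>\<alpha>\<in>Field \<kappa>. (\<forall>\<beta>\<in>under \<kappa> \<alpha>. played_round \<kappa> X \<sigma> m V \<beta>) \<longrightarrow> legal_II \<kappa> X V \<alpha> (m \<alpha>) (V \<alpha>)) \<and>
        ((\<forall>\<alpha>\<in>Field \<kappa>. played_round \<kappa> X \<sigma> m V \<alpha>) \<longrightarrow> (\<Inter>\<alpha>\<in>Field \<kappa>. V \<alpha>) \<noteq> {}))"

definition fSC_space :: "'k rel \<Rightarrow> 'a topology \<Rightarrow> bool" where
  "fSC_space \<kappa> X \<longleftrightarrow>
     regular_space X \<and> Hausdorff_space X \<and> weight_le X \<kappa> \<and> (\<exists>\<sigma>. winning_strategy_II \<kappa> X \<sigma>)"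

end

theory Submission
  imports Defs
begin

text \<open>Why the class is closed under the three operations.

  The game is first brought into a normal form. A reply \<open>V \<alpha>\<close> is open only relative to the intersection of
  the earlier replies, so it has the form \<open>N \<alpha> \<inter> (\<Inter>\<beta><\<alpha>. V \<beta>)\<close> with \<open>N \<alpha>\<close> open in the whole space. Replacing every
  \<open>V \<alpha>\<close> by \<open>N \<alpha>\<close> does not change these intersections, so both players may as well name open sets of the
  whole space. A winning strategy of II is then the same as a \<open>winning_response\<close>: a function from
  the sequence of moves of I to a sequence of open sets, each of which depends only on the moves made so far
  (\<open>winning_response_of_strategy\<close>, \<open>strategy_of_winning_response\<close>).

  In each construction II imagines games in the given spaces, translated from the actual one.
  At limit rounds the running intersection in an imagined game is nonempty whenever
  the actual one is. Fairness thus transfers: an imagined run does not end before the actual one.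

  For an intersection \<open>S\<close> of open sets \<open>W \<alpha>\<close>, II cuts the move of round \<open>\<alpha>\<close> down to \<open>W \<alpha>\<close> in the imagined
  game, which forces every point common to all replies into \<open>S\<close> (\<open>winning_response_Gdelta\<close>). In a sum, the first point
  played selects the summand in which the game takes place (\<open>winning_response_sum\<close>).

  In a product, II plays all coordinate games in parallel. A combined reply must restrict fewer
  than \<open>\<kappa>\<close> coordinates, so II may not begin to play in a coordinate before I has restricted it.
  Therefore one needs responses that answer with the whole space as long as I plays the whole space.
  They exist because a game whose beginning is postponed to a round \<open>\<delta> < \<kappa>\<close> still has \<open>\<kappa>\<close> rounds with the same
  limits (\<open>patient_winning_response\<close>). Regularity of \<open>\<kappa>\<close> then bounds the number of restricted
  coordinates (\<open>winning_response_product\<close>).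

  It remains to bound the weight. For products this is the statement that a set of size \<open>\<kappa>\<close> has at most \<open>\<kappa>\<close>
  many subsets of size less than \<open>\<kappa>\<close>, which follows from \<open>2\<^sup><\<^sup>\<kappa> = \<kappa>\<close> and regularity
  (\<open>small_subsets\<close>, \<open>weight_le_product\<close>). Regularity and the Hausdorff property of the spaces are inherited directly.\<close>

section \<open>Segments of a well-order\<close>

lemma well_order_laws:
  assumes "Well_order \<kappa>"
  shows "\<And>a b c. (a, b) \<in> \<kappa> \<Longrightarrow> (b, c) \<in> \<kappa> \<Longrightarrow> (a, c) \<in> \<kappa>"
    and "\<And>a b. (a, b) \<in> \<kappa> \<Longrightarrow> (b, a) \<in> \<kappa> \<Longrightarrow> a = b"
    and "\<And>a. a \<in> Field \<kappa> \<Longrightarrow> (a, a) \<in> \<kappa>"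
    and "\<And>a b. a \<in> Field \<kappa> \<Longrightarrow> b \<in> Field \<kappa> \<Longrightarrow> (a, b) \<in> \<kappa> \<or> (b, a) \<in> \<kappa>"
proof -
  have wo: "wo_rel \<kappa>" using assms by (simp add: wo_rel_def)
  show "\<And>a b c. (a, b) \<in> \<kappa> \<Longrightarrow> (b, c) \<in> \<kappa> \<Longrightarrow> (a, c) \<in> \<kappa>"
    using wo_rel.TRANS[OF wo] by (rule transD)
  show "\<And>a b. (a, b) \<in> \<kappa> \<Longrightarrow> (b, a) \<in> \<kappa> \<Longrightarrow> a = b"
    using wo_rel.ANTISYM[OF wo] by (rule antisymD)
  show "\<And>a b. a \<in> Field \<kappa> \<Longrightarrow> b \<in> Field \<kappa> \<Longrightarrow> (a, b) \<in> \<kappa> \<or> (b, a) \<in> \<kappa>"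
    using wo_rel.TOTALS[OF wo] by simp
  then show "\<And>a. a \<in> Field \<kappa> \<Longrightarrow> (a, a) \<in> \<kappa>" by blast
qed

lemma in_under_self: "Well_order \<kappa> \<Longrightarrow> \<alpha> \<in> Field \<kappa> \<Longrightarrow> \<alpha> \<in> under \<kappa> \<alpha>"
  by (simp add: under_def well_order_laws(3))

lemma under_mono:
  assumes "Well_order \<kappa>" "\<beta> \<in> under \<kappa> \<alpha>"
  shows "under \<kappa> \<beta> \<subseteq> under \<kappa> \<alpha>"
  using assms(2) by (auto simp: under_def intro: well_order_laws(1)[OF assms(1)])

lemma underS_mono:
  assumes "Well_order \<kappa>" "\<beta> \<in> under \<kappa> \<alpha>"
  shows "underS \<kappa> \<beta> \<subseteq> underS \<kappa> \<alpha>"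
  using assms(2) unfolding under_def underS_def
  by (auto intro: well_order_laws(1)[OF assms(1)] dest: well_order_laws(2)[OF assms(1)])

lemma under_subset_underS:
  assumes "Well_order \<kappa>" "\<beta> \<in> underS \<kappa> \<alpha>"
  shows "under \<kappa> \<beta> \<subseteq> underS \<kappa> \<alpha>"
  using assms(2) unfolding under_def underS_def
  by (auto intro: well_order_laws(1)[OF assms(1)] dest: well_order_laws(2)[OF assms(1)])

lemma under_in_Field: "\<beta> \<in> under \<kappa> \<alpha> \<Longrightarrow> \<beta> \<in> Field \<kappa>" "\<beta> \<in> underS \<kappa> \<alpha> \<Longrightarrow> \<beta> \<in> Field \<kappa>"
  by (auto simp: under_def underS_def Field_def)

lemma under_cases: "\<beta> \<in> under \<kappa> \<alpha> \<Longrightarrow> \<beta> = \<alpha> \<or> \<beta> \<in> underS \<kappa> \<alpha>"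
  by (auto simp: under_def underS_def)

lemma underS_or_above:
  assumes "Well_order \<kappa>" "\<alpha> \<in> Field \<kappa>" "\<delta> \<in> Field \<kappa>"
  shows "\<alpha> \<in> underS \<kappa> \<delta> \<or> \<alpha> \<in> above \<kappa> \<delta>"
  using well_order_laws(4)[OF assms] well_order_laws(3)[OF assms(1,2)]
  by (auto simp: underS_def above_def)

lemma under_inject:
  assumes "Well_order \<kappa>" "\<alpha> \<in> Field \<kappa>" "\<beta> \<in> Field \<kappa>" "under \<kappa> \<alpha> = under \<kappa> \<beta>"
  shows "\<alpha> = \<beta>"
proof (rule well_order_laws(2)[OF assms(1)])
  show "(\<alpha>, \<beta>) \<in> \<kappa>" "(\<beta>, \<alpha>) \<in> \<kappa>"
    using in_under_self[OF assms(1,2)] in_under_self[OF assms(1,3)] assms(4)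
    unfolding under_def by blast+
qed

lemma order_induct [consumes 1, case_names less]:
  assumes "Well_order \<kappa>" and step: "\<And>\<alpha>. (\<And>\<beta>. \<beta> \<in> underS \<kappa> \<alpha> \<Longrightarrow> P \<beta>) \<Longrightarrow> P \<alpha>"
  shows "P \<alpha>"
proof (rule wo_rel.well_order_induct[where r = \<kappa> and P = P])
  show "wo_rel \<kappa>" using assms(1) by (simp add: wo_rel_def)
  show "\<And>x. \<forall>y. y \<noteq> x \<and> (y, x) \<in> \<kappa> \<longrightarrow> P y \<Longrightarrow> P x"
    by (rule step) (simp add: underS_def)
qed

section \<open>Running intersections of a play\<close>

lemma current_set_cong:
  "(\<And>\<beta>. \<beta> \<in> underS \<kappa> \<alpha> \<Longrightarrow> V \<beta> = N \<beta>) \<Longrightarrow> current_set \<kappa> X V \<alpha> = current_set \<kappa> X N \<alpha>"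
  by (auto simp: current_set_def)

lemma current_set_cong_under:
  assumes "Well_order \<kappa>" "\<And>\<zeta>. \<zeta> \<in> underS \<kappa> \<alpha> \<Longrightarrow> V \<zeta> = N \<zeta>" "\<beta> \<in> under \<kappa> \<alpha>"
  shows "current_set \<kappa> X V \<beta> = current_set \<kappa> X N \<beta>"
  by (rule current_set_cong, rule assms(2)) (use underS_mono[OF assms(1,3)] in blast)

text \<open>When each \<open>V \<beta>\<close> is cut out of the intersection of its predecessors by \<open>N \<beta>\<close>, induction on \<open>\<beta>\<close> gives \<open>V \<beta> = (\<Inter>\<zeta>\<le>\<beta>. N \<zeta>)\<close> within the space,
  so the running intersections of \<open>V\<close> and \<open>N\<close> agree.\<close>

lemma current_set_eq_of_relative:
  assumes wo: "Well_order \<kappa>"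
    and rel: "\<And>\<beta>. \<beta> \<in> underS \<kappa> \<alpha> \<Longrightarrow> V \<beta> = N \<beta> \<inter> current_set \<kappa> X V \<beta>"
  shows "current_set \<kappa> X V \<alpha> = current_set \<kappa> X N \<alpha>"
proof
  show "current_set \<kappa> X V \<alpha> \<subseteq> current_set \<kappa> X N \<alpha>"
    using rel unfolding current_set_def by blast
  have "x \<in> V \<beta>" if x: "x \<in> current_set \<kappa> X N \<alpha>" and "\<beta> \<in> underS \<kappa> \<alpha>" for x \<beta>
    using wo that(2)
  proof (induction \<beta> rule: order_induct)
    case (less \<beta>)
    have "\<zeta> \<in> underS \<kappa> \<alpha>" if "\<zeta> \<in> underS \<kappa> \<beta>" for \<zeta>
      using that less.prems underS_mono[OF wo] underS_subset_under by fast
    then have "x \<in> current_set \<kappa> X V \<beta>"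
      using less.IH x unfolding current_set_def by auto
    then show ?case
      using rel[OF less.prems] x less.prems unfolding current_set_def by auto
  qed
  then show "current_set \<kappa> X N \<alpha> \<subseteq> current_set \<kappa> X V \<alpha>"
    unfolding current_set_def by auto
qed

lemma round_reached_cong:
  assumes "\<And>\<gamma>. \<gamma> \<in> under \<kappa> \<alpha> \<Longrightarrow> current_set \<kappa> X V \<gamma> = current_set \<kappa> Y N \<gamma>"
  shows "round_reached \<kappa> X V \<alpha> \<longleftrightarrow> round_reached \<kappa> Y N \<alpha>"
  using assms by (auto simp: round_reached_def)

lemma openin_subtopology_current_setD:
  assumes "openin (subtopology X (current_set \<kappa> X V \<alpha>)) U"
  shows "\<exists>N. openin X N \<and> U = N \<inter> current_set \<kappa> X V \<alpha>"
  using assms by (auto simp: openin_subtopology)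

section \<open>Responses as a normal form of strategies\<close>

definition causal :: "'k rel \<Rightarrow> (('k \<Rightarrow> 'm) \<Rightarrow> 'k \<Rightarrow> 'r) \<Rightarrow> bool" where
  "causal \<kappa> \<Phi> \<longleftrightarrow>
     (\<forall>m m'. \<forall>\<alpha>\<in>Field \<kappa>. (\<forall>\<beta>\<in>under \<kappa> \<alpha>. m \<beta> = m' \<beta>) \<longrightarrow> \<Phi> m \<alpha> = \<Phi> m' \<alpha>)"

text \<open>The analogue, for moves given by open subsets of the whole space, of a legal move of I in a round
  that is reached. The set that I actually plays is \<open>fst (m \<alpha>)\<close> intersected with the running
  intersection.\<close>

definition sound_round ::
  "'k rel \<Rightarrow> 'a topology \<Rightarrow> ('k \<Rightarrow> 'a set \<times> 'a) \<Rightarrow> ('k \<Rightarrow> 'a set) \<Rightarrow> 'k \<Rightarrow> bool" where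
  "sound_round \<kappa> X m N \<alpha> \<longleftrightarrow>
     round_reached \<kappa> X N \<alpha> \<and> openin X (fst (m \<alpha>)) \<and> snd (m \<alpha>) \<in> fst (m \<alpha>) \<inter> current_set \<kappa> X N \<alpha>"

text \<open>The normal form of a winning strategy of II. Both players name open subsets of \<open>X\<close>, and the
  reply \<open>\<Phi> m \<alpha>\<close> stands for the set \<open>\<Phi> m \<alpha> \<inter> current_set \<kappa> X (\<Phi> m) \<alpha>\<close>. It is a function of the moves of I
  alone, since II's own earlier replies are determined by them.\<close>

definition winning_response ::
  "'k rel \<Rightarrow> 'a topology \<Rightarrow> (('k \<Rightarrow> 'a set \<times> 'a) \<Rightarrow> 'k \<Rightarrow> 'a set) \<Rightarrow> bool" where
  "winning_response \<kappa> X \<Phi> \<longleftrightarrow> causal \<kappa> \<Phi> \<and>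
     (\<forall>m. (\<forall>\<alpha>\<in>Field \<kappa>. (\<forall>\<beta>\<in>under \<kappa> \<alpha>. sound_round \<kappa> X m (\<Phi> m) \<beta>) \<longrightarrow>
             openin X (\<Phi> m \<alpha>) \<and> snd (m \<alpha>) \<in> \<Phi> m \<alpha> \<and>
             \<Phi> m \<alpha> \<inter> current_set \<kappa> X (\<Phi> m) \<alpha> \<subseteq> fst (m \<alpha>)) \<and>
          ((\<forall>\<alpha>\<in>Field \<kappa>. sound_round \<kappa> X m (\<Phi> m) \<alpha>) \<longrightarrow>
             topspace X \<inter> (\<Inter>\<alpha>\<in>Field \<kappa>. \<Phi> m \<alpha>) \<noteq> {}))"

lemma winning_responseI:
  assumes "causal \<kappa> \<Phi>"
    and "\<And>m \<alpha>. \<alpha> \<in> Field \<kappa> \<Longrightarrow> (\<And>\<beta>. \<beta> \<in> under \<kappa> \<alpha> \<Longrightarrow> sound_round \<kappa> X m (\<Phi> m) \<beta>) \<Longrightarrow>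
           openin X (\<Phi> m \<alpha>) \<and> snd (m \<alpha>) \<in> \<Phi> m \<alpha> \<and>
           \<Phi> m \<alpha> \<inter> current_set \<kappa> X (\<Phi> m) \<alpha> \<subseteq> fst (m \<alpha>)"
    and "\<And>m. (\<And>\<alpha>. \<alpha> \<in> Field \<kappa> \<Longrightarrow> sound_round \<kappa> X m (\<Phi> m) \<alpha>) \<Longrightarrow>
           \<exists>x\<in>topspace X. \<forall>\<alpha>\<in>Field \<kappa>. x \<in> \<Phi> m \<alpha>"
  shows "winning_response \<kappa> X \<Phi>"
proof -
  have "topspace X \<inter> (\<Inter>\<alpha>\<in>Field \<kappa>. \<Phi> m \<alpha>) \<noteq> {}" if "\<forall>\<alpha>\<in>Field \<kappa>. sound_round \<kappa> X m (\<Phi> m) \<alpha>" for m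
  proof -
    have "\<exists>x\<in>topspace X. \<forall>\<alpha>\<in>Field \<kappa>. x \<in> \<Phi> m \<alpha>"
      by (rule assms(3)) (use that in blast)
    then show ?thesis by blast
  qed
  then show ?thesis
    using assms(1,2) unfolding winning_response_def by blast
qed

lemma winning_responseD:
  assumes "winning_response \<kappa> X \<Phi>" "\<alpha> \<in> Field \<kappa>"
    and "\<And>\<beta>. \<beta> \<in> under \<kappa> \<alpha> \<Longrightarrow> sound_round \<kappa> X m (\<Phi> m) \<beta>"
  shows "openin X (\<Phi> m \<alpha>)" "snd (m \<alpha>) \<in> \<Phi> m \<alpha>"
    "\<Phi> m \<alpha> \<inter> current_set \<kappa> X (\<Phi> m) \<alpha> \<subseteq> fst (m \<alpha>)"
proof -
  have "\<forall>\<beta>\<in>under \<kappa> \<alpha>. sound_round \<kappa> X m (\<Phi> m) \<beta>" using assms(3) by simp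
  then show "openin X (\<Phi> m \<alpha>)" "snd (m \<alpha>) \<in> \<Phi> m \<alpha>"
    "\<Phi> m \<alpha> \<inter> current_set \<kappa> X (\<Phi> m) \<alpha> \<subseteq> fst (m \<alpha>)"
    using assms(1,2) unfolding winning_response_def by simp_all
qed

lemma winning_response_wins:
  assumes "winning_response \<kappa> X \<Phi>" "\<And>\<alpha>. \<alpha> \<in> Field \<kappa> \<Longrightarrow> sound_round \<kappa> X m (\<Phi> m) \<alpha>"
  shows "\<exists>x\<in>topspace X. \<forall>\<alpha>\<in>Field \<kappa>. x \<in> \<Phi> m \<alpha>"
proof -
  have "\<forall>\<alpha>\<in>Field \<kappa>. sound_round \<kappa> X m (\<Phi> m) \<alpha>" using assms(2) by simp
  then have "topspace X \<inter> (\<Inter>\<alpha>\<in>Field \<kappa>. \<Phi> m \<alpha>) \<noteq> {}"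
    using assms(1) unfolding winning_response_def by simp
  then show ?thesis by blast
qed

lemma causalD:
  "causal \<kappa> \<Phi> \<Longrightarrow> \<alpha> \<in> Field \<kappa> \<Longrightarrow> (\<And>\<beta>. \<beta> \<in> under \<kappa> \<alpha> \<Longrightarrow> m \<beta> = m' \<beta>) \<Longrightarrow> \<Phi> m \<alpha> = \<Phi> m' \<alpha>"
  unfolding causal_def by blast

lemma winning_response_causal: "winning_response \<kappa> X \<Phi> \<Longrightarrow> causal \<kappa> \<Phi>"
  by (simp add: winning_response_def)

text \<open>Well-founded recursion plays the strategy against the relativized moves of I, and each relatively
  open reply is then extended to an open set. By induction on the rounds the extended
  replies have the same running intersections as the real ones, so a play that is sound for the
  extensions is a legal run against the strategy.\<close>

lemma winning_response_of_strategy: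
  assumes wo: "Well_order \<kappa>" and ne: "Field \<kappa> \<noteq> {}" and win: "winning_strategy_II \<kappa> X \<sigma>"
  shows "\<exists>\<Phi>. winning_response \<kappa> X \<Phi>"
proof -
  \<comment> \<open>The legal move of I that an open set and a point stand for, once II has played \<open>V\<close>.\<close>
  define rel :: "_ \<Rightarrow> _ \<Rightarrow> _ \<Rightarrow> 'b set \<times> 'b"
    where "rel m V \<beta> = (fst (m \<beta>) \<inter> current_set \<kappa> X V \<beta>, snd (m \<beta>))" for m V \<beta>
  define H where "H m V \<alpha> = \<sigma> ((Some \<circ> rel m V) |` under \<kappa> \<alpha>) ((Some \<circ> V) |` underS \<kappa> \<alpha>)" for m V \<alpha>
  define run where "run m = wo_rel.worec \<kappa> (H m)" for m
  have H_cong: "H m V \<alpha> = H m' V' \<alpha>"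
    if "\<And>\<beta>. \<beta> \<in> under \<kappa> \<alpha> \<Longrightarrow> m \<beta> = m' \<beta>" "\<And>\<beta>. \<beta> \<in> underS \<kappa> \<alpha> \<Longrightarrow> V \<beta> = V' \<beta>" for m m' V V' \<alpha>
  proof -
    have "rel m V \<beta> = rel m' V' \<beta>" if "\<beta> \<in> under \<kappa> \<alpha>" for \<beta>
      using current_set_cong_under[OF wo \<open>\<And>\<beta>. \<beta> \<in> underS \<kappa> \<alpha> \<Longrightarrow> V \<beta> = V' \<beta>\<close> that]
        \<open>\<And>\<beta>. \<beta> \<in> under \<kappa> \<alpha> \<Longrightarrow> m \<beta> = m' \<beta>\<close>[OF that] by (simp add: rel_def)
    then have "(Some \<circ> rel m V) |` under \<kappa> \<alpha> = (Some \<circ> rel m' V') |` under \<kappa> \<alpha>"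
      by (auto simp: restrict_map_def)
    moreover have "(Some \<circ> V) |` underS \<kappa> \<alpha> = (Some \<circ> V') |` underS \<kappa> \<alpha>"
      using that(2) by (auto simp: restrict_map_def)
    ultimately show ?thesis by (simp add: H_def)
  qed
  have run: "run m \<alpha> = H m (run m) \<alpha>" for m \<alpha>
  proof -
    have "wo_rel.adm_wo \<kappa> (H m)"
      using wo by (auto simp: wo_rel.adm_wo_def wo_rel_def intro!: H_cong)
    then show ?thesis
      using wo_rel.worec_fixpoint[of \<kappa> "H m"] wo unfolding run_def wo_rel_def by metis
  qed
  \<comment> \<open>The extension of the reply; any default value will do in a play with an illegal move.\<close>
  define \<Phi> where "\<Phi> m \<alpha> = (SOME N. openin X N \<and> run m \<alpha> = N \<inter> current_set \<kappa> X (run m) \<alpha>)" for m \<alpha>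
  have "causal \<kappa> \<Phi>"
    unfolding causal_def
  proof (intro allI ballI impI)
    fix m m' :: "'a \<Rightarrow> 'b set \<times> 'b" and \<alpha>
    assume eq: "\<forall>\<beta>\<in>under \<kappa> \<alpha>. m \<beta> = m' \<beta>" and "\<alpha> \<in> Field \<kappa>"
    have *: "run m \<beta> = run m' \<beta>" if "\<beta> \<in> under \<kappa> \<alpha>" for \<beta>
      using wo that
    proof (induction \<beta> rule: order_induct)
      case (less \<beta>)
      have "H m (run m) \<beta> = H m' (run m') \<beta>"
      proof (rule H_cong)
        show "m \<zeta> = m' \<zeta>" if "\<zeta> \<in> under \<kappa> \<beta>" for \<zeta>
          using eq that under_mono[OF wo less.prems] by blast
        show "run m \<zeta> = run m' \<zeta>" if "\<zeta> \<in> underS \<kappa> \<beta>" for \<zeta>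
          using less.IH[OF that] that under_mono[OF wo less.prems] underS_subset_under by fast
      qed
      then show ?case using run by metis
    qed
    have "current_set \<kappa> X (run m) \<alpha> = current_set \<kappa> X (run m') \<alpha>"
      using * underS_subset_under by (intro current_set_cong) fast
    moreover have "run m \<alpha> = run m' \<alpha>"
      using * in_under_self[OF wo \<open>\<alpha> \<in> Field \<kappa>\<close>] by blast
    ultimately show "\<Phi> m \<alpha> = \<Phi> m' \<alpha>" by (simp add: \<Phi>_def)
  qed
  have step: "played_round \<kappa> X \<sigma> (rel m (run m)) (run m) \<alpha> \<and> openin X (\<Phi> m \<alpha>) \<and>
      run m \<alpha> = \<Phi> m \<alpha> \<inter> current_set \<kappa> X (run m) \<alpha> \<and>
      current_set \<kappa> X (run m) \<alpha> = current_set \<kappa> X (\<Phi> m) \<alpha> \<and> snd (m \<alpha>) \<in> run m \<alpha> \<and> run m \<alpha> \<subseteq> fst (m \<alpha>)"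
    if "\<alpha> \<in> Field \<kappa>" "\<And>\<beta>. \<beta> \<in> under \<kappa> \<alpha> \<Longrightarrow> sound_round \<kappa> X m (\<Phi> m) \<beta>" for m \<alpha>
    using wo that
  proof (induction \<alpha> rule: order_induct)
    case (less \<alpha>)
    have IH: "run m \<beta> = \<Phi> m \<beta> \<inter> current_set \<kappa> X (run m) \<beta>"
        "played_round \<kappa> X \<sigma> (rel m (run m)) (run m) \<beta>" if "\<beta> \<in> underS \<kappa> \<alpha>" for \<beta>
      using less.IH[OF that] less.prems(2) under_in_Field(2)[OF that] under_subset_underS[OF wo that]
        underS_subset_under[of \<kappa> \<alpha>] by blast+
    have cur: "current_set \<kappa> X (run m) \<beta> = current_set \<kappa> X (\<Phi> m) \<beta>" if "\<beta> \<in> under \<kappa> \<alpha>" for \<beta>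
      using IH(1) underS_mono[OF wo that] by (intro current_set_eq_of_relative[OF wo]) blast
    have "\<alpha> \<in> under \<kappa> \<alpha>" using in_under_self[OF wo less.prems(1)] .
    then have snd: "sound_round \<kappa> X m (\<Phi> m) \<alpha>" using less.prems(2) by blast
    have reached: "round_reached \<kappa> X (run m) \<alpha>"
      using snd cur round_reached_cong[of \<kappa> \<alpha> X "run m" X "\<Phi> m"] unfolding sound_round_def by blast
    have "openin (subtopology X (current_set \<kappa> X (run m) \<alpha>)) (fst (m \<alpha>) \<inter> current_set \<kappa> X (run m) \<alpha>)"
      using snd unfolding sound_round_def openin_subtopology by blast
    then have "legal_I \<kappa> X (run m) \<alpha> (rel m (run m) \<alpha>)"
      using snd cur[OF \<open>\<alpha> \<in> under \<kappa> \<alpha>\<close>] unfolding legal_I_def rel_def sound_round_def by auto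
    moreover have "follows_strategy \<kappa> \<sigma> (rel m (run m)) (run m) \<alpha>"
      using run[of m \<alpha>] unfolding follows_strategy_def H_def .
    ultimately have played: "played_round \<kappa> X \<sigma> (rel m (run m)) (run m) \<alpha>"
      using reached unfolding played_round_def by blast
    then have "\<forall>\<beta>\<in>under \<kappa> \<alpha>. played_round \<kappa> X \<sigma> (rel m (run m)) (run m) \<beta>"
      using IH(2) under_cases by metis
    then have legal: "legal_II \<kappa> X (run m) \<alpha> (rel m (run m) \<alpha>) (run m \<alpha>)"
      using win less.prems(1) unfolding winning_strategy_II_def by blast
    then have "\<exists>N. openin X N \<and> run m \<alpha> = N \<inter> current_set \<kappa> X (run m) \<alpha>"
      by (intro openin_subtopology_current_setD) (simp add: legal_II_def split: prod.splits)
    then have "openin X (\<Phi> m \<alpha>) \<and> run m \<alpha> = \<Phi> m \<alpha> \<inter> current_set \<kappa> X (run m) \<alpha>"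
      unfolding \<Phi>_def by (rule someI_ex)
    then show ?case
      using played legal cur[OF \<open>\<alpha> \<in> under \<kappa> \<alpha>\<close>] unfolding legal_II_def rel_def by auto
  qed
  have "winning_response \<kappa> X \<Phi>"
  proof (rule winning_responseI[OF \<open>causal \<kappa> \<Phi>\<close>])
    fix m \<alpha> assume "\<alpha> \<in> Field \<kappa>" "\<And>\<beta>. \<beta> \<in> under \<kappa> \<alpha> \<Longrightarrow> sound_round \<kappa> X m (\<Phi> m) \<beta>"
    from step[OF this] show "openin X (\<Phi> m \<alpha>) \<and> snd (m \<alpha>) \<in> \<Phi> m \<alpha> \<and>
           \<Phi> m \<alpha> \<inter> current_set \<kappa> X (\<Phi> m) \<alpha> \<subseteq> fst (m \<alpha>)"
      by auto
  next
    fix m assume sound: "\<And>\<alpha>. \<alpha> \<in> Field \<kappa> \<Longrightarrow> sound_round \<kappa> X m (\<Phi> m) \<alpha>"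
    have *: "played_round \<kappa> X \<sigma> (rel m (run m)) (run m) \<alpha>"
      "run m \<alpha> = \<Phi> m \<alpha> \<inter> current_set \<kappa> X (run m) \<alpha>" if "\<alpha> \<in> Field \<kappa>" for \<alpha>
      using step[OF that] sound under_in_Field(1)[of _ \<kappa>] by blast+
    have "(\<Inter>\<alpha>\<in>Field \<kappa>. run m \<alpha>) \<noteq> {}"
      using win *(1) unfolding winning_strategy_II_def by blast
    then obtain x where x: "\<And>\<alpha>. \<alpha> \<in> Field \<kappa> \<Longrightarrow> x \<in> run m \<alpha>" by blast
    show "\<exists>x\<in>topspace X. \<forall>\<alpha>\<in>Field \<kappa>. x \<in> \<Phi> m \<alpha>"
    proof
      show "x \<in> topspace X" using ne x *(2) unfolding current_set_def by blast
      show "\<forall>\<alpha>\<in>Field \<kappa>. x \<in> \<Phi> m \<alpha>" using x *(2) by blast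
    qed
  qed
  then show ?thesis by (intro exI)
qed

text \<open>The strategy sees the earlier replies, so it can compute the running intersection at each round,
  extend the relatively open moves of I to open sets, and apply the response to these.\<close>

lemma strategy_of_winning_response:
  assumes wo: "Well_order \<kappa>" and win: "winning_response \<kappa> X \<Phi>"
  shows "\<exists>\<sigma>. winning_strategy_II \<kappa> X \<sigma>"
proof -
  define lift where
    "lift m V \<beta> = (SOME U. openin X U \<and> fst (m \<beta>) = U \<inter> current_set \<kappa> X V \<beta>, snd (m \<beta>))"
    for m :: "'a \<Rightarrow> 'b set \<times> 'b" and V \<beta>
  \<comment> \<open>The current round is recovered as the last one in the domain of the history of I's moves.\<close>
  define \<sigma> :: "('a, 'b) strategy_II" where
    "\<sigma> mh Vh = (let \<alpha> = (THE \<alpha>. \<alpha> \<in> Field \<kappa> \<and> dom mh = under \<kappa> \<alpha>)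
       in \<Phi> (lift (the \<circ> mh) (the \<circ> Vh)) \<alpha> \<inter> current_set \<kappa> X (the \<circ> Vh) \<alpha>)" for mh Vh
  have eq: "V \<alpha> = \<Phi> (lift m V) \<alpha> \<inter> current_set \<kappa> X V \<alpha>"
    if "\<alpha> \<in> Field \<kappa>" "follows_strategy \<kappa> \<sigma> m V \<alpha>" for m V \<alpha>
  proof -
    let ?m = "(Some \<circ> m) |` under \<kappa> \<alpha>" and ?V = "(Some \<circ> V) |` underS \<kappa> \<alpha>"
    have "dom ?m = under \<kappa> \<alpha>" by (auto simp: dom_def restrict_map_def)
    then have the: "(THE \<alpha>. \<alpha> \<in> Field \<kappa> \<and> dom ?m = under \<kappa> \<alpha>) = \<alpha>"
      using that(1) under_inject[OF wo] by (intro the_equality) auto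
    have V: "(the \<circ> ?V) \<beta> = V \<beta>" if "\<beta> \<in> underS \<kappa> \<alpha>" for \<beta>
      using that by simp
    have "\<Phi> (lift (the \<circ> ?m) (the \<circ> ?V)) \<alpha> = \<Phi> (lift m V) \<alpha>"
    proof (rule causalD[OF winning_response_causal[OF win] that(1)])
      fix \<beta> assume \<beta>: "\<beta> \<in> under \<kappa> \<alpha>"
      have cur: "current_set \<kappa> X (the \<circ> ?V) \<beta> = current_set \<kappa> X V \<beta>"
        by (rule current_set_cong_under[OF wo _ \<beta>]) (rule V)
      show "lift (the \<circ> ?m) (the \<circ> ?V) \<beta> = lift m V \<beta>"
        using cur \<beta> by (simp add: lift_def)
    qed
    moreover have "current_set \<kappa> X (the \<circ> ?V) \<alpha> = current_set \<kappa> X V \<alpha>"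
      using V by (intro current_set_cong)
    ultimately show ?thesis
      using that(2) unfolding follows_strategy_def \<sigma>_def Let_def the by simp
  qed
  have sound: "sound_round \<kappa> X (lift m V) (\<Phi> (lift m V)) \<alpha> \<and>
      current_set \<kappa> X V \<alpha> = current_set \<kappa> X (\<Phi> (lift m V)) \<alpha> \<and>
      fst (m \<alpha>) = fst (lift m V \<alpha>) \<inter> current_set \<kappa> X V \<alpha>"
    if \<alpha>: "\<alpha> \<in> Field \<kappa>" and played: "\<And>\<beta>. \<beta> \<in> under \<kappa> \<alpha> \<Longrightarrow> played_round \<kappa> X \<sigma> m V \<beta>" for m V \<alpha>
  proof -
    have cur: "current_set \<kappa> X V \<beta> = current_set \<kappa> X (\<Phi> (lift m V)) \<beta>" if "\<beta> \<in> under \<kappa> \<alpha>" for \<beta>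
    proof (rule current_set_eq_of_relative[OF wo], rule eq)
      fix \<zeta> assume \<zeta>: "\<zeta> \<in> underS \<kappa> \<beta>"
      then show "\<zeta> \<in> Field \<kappa>" by (rule under_in_Field(2))
      have "\<zeta> \<in> under \<kappa> \<alpha>"
        using \<zeta> underS_mono[OF wo that] underS_subset_under[of \<kappa> \<alpha>] by blast
      from played[OF this] show "follows_strategy \<kappa> \<sigma> m V \<zeta>"
        unfolding played_round_def by blast
    qed
    have self: "\<alpha> \<in> under \<kappa> \<alpha>" using in_under_self[OF wo \<alpha>] .
    have "round_reached \<kappa> X (\<Phi> (lift m V)) \<alpha>"
      using played[OF self] cur round_reached_cong[of \<kappa> \<alpha> X V X "\<Phi> (lift m V)"]
      unfolding played_round_def by blast
    moreover have I: "openin (subtopology X (current_set \<kappa> X V \<alpha>)) (fst (m \<alpha>))" "snd (m \<alpha>) \<in> fst (m \<alpha>)"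
      using played[OF self] unfolding played_round_def legal_I_def by (auto split: prod.splits)
    have "openin X (fst (lift m V \<alpha>)) \<and> fst (m \<alpha>) = fst (lift m V \<alpha>) \<inter> current_set \<kappa> X V \<alpha>"
      unfolding lift_def fst_conv by (rule someI_ex[OF openin_subtopology_current_setD[OF I(1)]])
    ultimately show ?thesis
      using I(2) cur[OF self] unfolding sound_round_def by (auto simp: lift_def)
  qed
  have "winning_strategy_II \<kappa> X \<sigma>"
    unfolding winning_strategy_II_def
  proof (intro allI conjI ballI impI)
    fix m V \<alpha> assume \<alpha>: "\<alpha> \<in> Field \<kappa>" and "\<forall>\<beta>\<in>under \<kappa> \<alpha>. played_round \<kappa> X \<sigma> m V \<beta>"
    then have played: "\<And>\<beta>. \<beta> \<in> under \<kappa> \<alpha> \<Longrightarrow> played_round \<kappa> X \<sigma> m V \<beta>" by blast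
    have "sound_round \<kappa> X (lift m V) (\<Phi> (lift m V)) \<beta>" if "\<beta> \<in> under \<kappa> \<alpha>" for \<beta>
      using sound[OF under_in_Field(1)[OF that] played] under_mono[OF wo that] by blast
    note D = winning_responseD[OF win \<alpha> this]
    have self: "\<alpha> \<in> under \<kappa> \<alpha>" using in_under_self[OF wo \<alpha>] .
    then have V: "V \<alpha> = \<Phi> (lift m V) \<alpha> \<inter> current_set \<kappa> X V \<alpha>"
      using eq[OF \<alpha>] played unfolding played_round_def by blast
    have "openin (subtopology X (current_set \<kappa> X V \<alpha>)) (V \<alpha>)"
      using V D(1) unfolding openin_subtopology by blast
    moreover have "snd (m \<alpha>) \<in> V \<alpha>" "V \<alpha> \<subseteq> fst (m \<alpha>)"
    proof -
      have s: "snd (lift m V \<alpha>) \<in> current_set \<kappa> X V \<alpha>" "snd (lift m V \<alpha>) = snd (m \<alpha>)"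
          "current_set \<kappa> X V \<alpha> = current_set \<kappa> X (\<Phi> (lift m V)) \<alpha>"
          "fst (m \<alpha>) = fst (lift m V \<alpha>) \<inter> current_set \<kappa> X V \<alpha>"
        using sound[OF \<alpha> played] unfolding sound_round_def by (blast, simp add: lift_def, blast, blast)
      show "snd (m \<alpha>) \<in> V \<alpha>" using s(1,2) D(2) by (subst V) simp
      show "V \<alpha> \<subseteq> fst (m \<alpha>)" using s(3,4) D(3) by (subst V) blast
    qed
    ultimately show "legal_II \<kappa> X V \<alpha> (m \<alpha>) (V \<alpha>)"
      unfolding legal_II_def case_prod_beta by blast
  next
    fix m V assume "\<forall>\<alpha>\<in>Field \<kappa>. played_round \<kappa> X \<sigma> m V \<alpha>"
    then have played: "\<And>\<alpha>. \<alpha> \<in> Field \<kappa> \<Longrightarrow> played_round \<kappa> X \<sigma> m V \<alpha>" by blast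
    have "\<exists>x\<in>topspace X. \<forall>\<alpha>\<in>Field \<kappa>. x \<in> \<Phi> (lift m V) \<alpha>"
    proof (rule winning_response_wins[OF win])
      fix \<alpha> assume \<alpha>: "\<alpha> \<in> Field \<kappa>"
      show "sound_round \<kappa> X (lift m V) (\<Phi> (lift m V)) \<alpha>"
        using sound[OF \<alpha>, of m V] played[OF under_in_Field(1)[where \<alpha> = \<alpha>]] by simp
    qed
    then obtain x where x: "x \<in> topspace X" "\<forall>\<alpha>\<in>Field \<kappa>. x \<in> \<Phi> (lift m V) \<alpha>" by blast
    have "x \<in> V \<alpha>" if "\<alpha> \<in> Field \<kappa>" for \<alpha>
    proof -
      have "x \<in> current_set \<kappa> X (\<Phi> (lift m V)) \<alpha>"
        using x under_in_Field(2) unfolding current_set_def by fast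
      then have "x \<in> current_set \<kappa> X V \<alpha>"
        using sound[OF that, of m V] played[OF under_in_Field(1)[where \<alpha> = \<alpha>]] by simp
      then show ?thesis
        using eq[OF that] played[OF that] x(2) that unfolding played_round_def by blast
    qed
    then show "(\<Inter>\<alpha>\<in>Field \<kappa>. V \<alpha>) \<noteq> {}" by blast
  qed
  then show ?thesis by (intro exI)
qed

section \<open>Patient responses\<close>

text \<open>A final segment of an infinite cardinal \<open>\<kappa>\<close> has cardinality \<open>\<kappa>\<close>, because the initial segment it leaves
  out is smaller; since all its proper initial segments are smaller than \<open>\<kappa>\<close>, its order type
  is \<open>\<kappa>\<close> again. The isomorphism \<open>f\<close> is addition of \<open>\<delta>\<close> on the left.\<close>

lemma shift_exists:
  assumes card: "Card_order \<kappa>" and inf: "infinite (Field \<kappa>)" and \<delta>: "\<delta> \<in> Field \<kappa>"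
  shows "\<exists>f. bij_betw f (Field \<kappa>) (above \<kappa> \<delta>) \<and>
    (\<forall>\<beta>\<in>Field \<kappa>. f ` under \<kappa> \<beta> = under \<kappa> (f \<beta>) \<inter> above \<kappa> \<delta> \<and>
       f ` underS \<kappa> \<beta> = underS \<kappa> (f \<beta>) \<inter> above \<kappa> \<delta>)"
proof -
  have wo: "Well_order \<kappa>" using card by (rule card_order_on_well_order_on)
  define r where "r = Restr \<kappa> (above \<kappa> \<delta>)"
  have sub: "above \<kappa> \<delta> \<subseteq> Field \<kappa>" by (auto simp: above_def Field_def)
  have wor: "Well_order r" unfolding r_def using wo by (rule Well_order_Restr)
  have Fr: "Field r = above \<kappa> \<delta>"
    unfolding r_def using wo sub
    by (intro Refl_Field_Restr2) (auto simp: wo_rel.REFL wo_rel_def)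
  have large: "\<not> |above \<kappa> \<delta>| <o \<kappa>"
  proof
    assume small: "|above \<kappa> \<delta>| <o \<kappa>"
    have "Field \<kappa> = underS \<kappa> \<delta> \<union> above \<kappa> \<delta>"
      using underS_or_above[OF wo _ \<delta>] sub under_in_Field(2)[of _ \<kappa> \<delta>] by blast
    then have "|Field \<kappa>| <o \<kappa>"
      using card_of_Un_ordLess_infinite_Field[OF inf card card_of_underS[OF card \<delta>] small] by simp
    then show False
      using card_of_Field_ordIso[OF card] not_ordLess_ordIso by blast
  qed
  have "\<not> r <o \<kappa>"
    using large card_of_least[OF wor] ordLeq_ordLess_trans unfolding Fr by blast
  then have "\<kappa> \<le>o r"
    using ordLess_or_ordLeq[OF wor wo] by blast
  then obtain f where f: "embed \<kappa> r f" unfolding ordLeq_def by blast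
  have inj: "inj_on f (Field \<kappa>)" using embed_inj_on[OF wo f] .
  have "wo_rel.ofilter r (f ` Field \<kappa>)" using embed_Field_ofilter[OF wo wor f] .
  then have "(\<exists>a\<in>Field r. f ` Field \<kappa> = underS r a) \<or> f ` Field \<kappa> = Field r"
    using wo_rel.ofilter_underS_Field[of r] wor unfolding wo_rel_def by blast
  moreover have "f ` Field \<kappa> \<noteq> underS r a" if "a \<in> Field r" for a
  proof
    assume eq: "f ` Field \<kappa> = underS r a"
    have "underS r a \<subseteq> underS \<kappa> a" unfolding r_def underS_def by blast
    then have "|Field \<kappa>| \<le>o |underS \<kappa> a|"
      using card_of_ordLeq[of "Field \<kappa>" "underS \<kappa> a"] inj eq by blast
    moreover have "|underS \<kappa> a| <o \<kappa>" using card_of_underS[OF card] that sub Fr by blast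
    ultimately show False
      using card_of_Field_ordIso[OF card] ordLeq_ordLess_trans not_ordLess_ordIso by blast
  qed
  ultimately have img: "f ` Field \<kappa> = above \<kappa> \<delta>" using Fr by blast
  have "f ` under \<kappa> \<beta> = under \<kappa> (f \<beta>) \<inter> above \<kappa> \<delta> \<and>
       f ` underS \<kappa> \<beta> = underS \<kappa> (f \<beta>) \<inter> above \<kappa> \<delta>" if "\<beta> \<in> Field \<kappa>" for \<beta>
  proof -
    have "f \<beta> \<in> above \<kappa> \<delta>" using img that by blast
    then have "under r (f \<beta>) = under \<kappa> (f \<beta>) \<inter> above \<kappa> \<delta>" 
      "underS r (f \<beta>) = underS \<kappa> (f \<beta>) \<inter> above \<kappa> \<delta>"
      unfolding r_def under_def underS_def by blast+
    then show ?thesis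
      using f that embed_underS[OF wo f that] unfolding embed_def bij_betw_def by simp
  qed
  then show ?thesis using inj img unfolding bij_betw_def by blast
qed

lemma least_in_order:
  assumes wo: "Well_order \<kappa>" and "\<beta> \<in> under \<kappa> \<alpha>" "P \<beta>"
  shows "\<exists>!\<delta>. \<delta> \<in> under \<kappa> \<alpha> \<and> P \<delta> \<and> (\<forall>\<zeta>\<in>underS \<kappa> \<delta>. \<not> P \<zeta>)"
proof (rule ex_ex1I)
  show "\<exists>\<delta>. \<delta> \<in> under \<kappa> \<alpha> \<and> P \<delta> \<and> (\<forall>\<zeta>\<in>underS \<kappa> \<delta>. \<not> P \<zeta>)"
    using wo assms(2,3)
  proof (induction \<beta> rule: order_induct)
    case (less \<beta>)
    show ?case
    proof (cases "\<exists>\<zeta>\<in>underS \<kappa> \<beta>. P \<zeta>")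
      case True
      then show ?thesis
        using less under_mono[OF wo less.prems(1)] underS_subset_under[of \<kappa> \<beta>] by blast
    qed (use less in blast)
  qed
next
  fix \<delta> \<delta>'
  assume "\<delta> \<in> under \<kappa> \<alpha> \<and> P \<delta> \<and> (\<forall>\<zeta>\<in>underS \<kappa> \<delta>. \<not> P \<zeta>)" "\<delta>' \<in> under \<kappa> \<alpha> \<and> P \<delta>' \<and> (\<forall>\<zeta>\<in>underS \<kappa> \<delta>'. \<not> P \<zeta>)"
  moreover from this have "\<delta> \<in> Field \<kappa>" "\<delta>' \<in> Field \<kappa>" using under_in_Field(1) by fast+
  ultimately show "\<delta> = \<delta>'"
    using well_order_laws(4)[OF wo, of \<delta> \<delta>'] unfolding underS_def by blast
qed

definition patient :: "'k rel \<Rightarrow> 'a topology \<Rightarrow> (('k \<Rightarrow> 'a set \<times> 'a) \<Rightarrow> 'k \<Rightarrow> 'a set) \<Rightarrow> bool" where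
  "patient \<kappa> X \<Phi> \<longleftrightarrow>
     (\<forall>m. \<forall>\<alpha>\<in>Field \<kappa>. (\<forall>\<beta>\<in>under \<kappa> \<alpha>. fst (m \<beta>) = topspace X) \<longrightarrow> \<Phi> m \<alpha> = topspace X)"

text \<open>II waits until I first plays a proper subset, in round \<open>\<delta>\<close>, and then starts the given response as if
  round \<open>\<delta>\<close> were the first one. Since \<open>\<delta> + \<gamma>\<close> is a limit whenever \<open>\<gamma>\<close> is, the postponed game meets
  empty intersections at limits only where the actual game does. Since \<open>\<delta> + \<kappa> = \<kappa>\<close>, it also lasts
  \<open>\<kappa>\<close> rounds. Playing the \<open>\<delta>\<close> missed rounds all at once would not work: the resulting set is an
  intersection of fewer than \<open>\<kappa>\<close> open sets, which need not be open.\<close>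

lemma patient_winning_response:
  fixes \<kappa> :: "'k rel" and X :: "'a topology"
  assumes card: "Card_order \<kappa>" and inf: "infinite (Field \<kappa>)" and win: "winning_response \<kappa> X \<Phi>"
  shows "\<exists>\<Psi>. winning_response \<kappa> X \<Psi> \<and> patient \<kappa> X \<Psi>"
proof -
  have wo: "Well_order \<kappa>" using card by (rule card_order_on_well_order_on)
  define f where "f \<delta> = (SOME f. bij_betw f (Field \<kappa>) (above \<kappa> \<delta>) \<and>
    (\<forall>\<beta>\<in>Field \<kappa>. f ` under \<kappa> \<beta> = under \<kappa> (f \<beta>) \<inter> above \<kappa> \<delta> \<and>
       f ` underS \<kappa> \<beta> = underS \<kappa> (f \<beta>) \<inter> above \<kappa> \<delta>))" for \<delta>
  have f: "bij_betw (f \<delta>) (Field \<kappa>) (above \<kappa> \<delta>)"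
      "\<And>\<beta>. \<beta> \<in> Field \<kappa> \<Longrightarrow> f \<delta> ` under \<kappa> \<beta> = under \<kappa> (f \<delta> \<beta>) \<inter> above \<kappa> \<delta>"
      "\<And>\<beta>. \<beta> \<in> Field \<kappa> \<Longrightarrow> f \<delta> ` underS \<kappa> \<beta> = underS \<kappa> (f \<delta> \<beta>) \<inter> above \<kappa> \<delta>"
    if "\<delta> \<in> Field \<kappa>" for \<delta>
    using someI_ex[OF shift_exists[OF card inf that]] unfolding f_def by blast+
  define starts where "starts m \<alpha> \<delta> \<longleftrightarrow> \<delta> \<in> under \<kappa> \<alpha> \<and> fst (m \<delta>) \<noteq> topspace X \<and>
      (\<forall>\<zeta>\<in>underS \<kappa> \<delta>. \<not> fst (m \<zeta>) \<noteq> topspace X)" for m :: "'k \<Rightarrow> 'a set \<times> 'a" and \<alpha> \<delta>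
  have starts_cong: "starts m \<alpha> = starts m' \<alpha>"
    if "\<And>\<beta>. \<beta> \<in> under \<kappa> \<alpha> \<Longrightarrow> m \<beta> = m' \<beta>" for m m' \<alpha>
  proof (rule ext)
    fix \<delta>
    have "m \<zeta> = m' \<zeta>" if "\<delta> \<in> under \<kappa> \<alpha>" "\<zeta> \<in> underS \<kappa> \<delta>" for \<zeta>
      using that(2) \<open>\<And>\<beta>. \<beta> \<in> under \<kappa> \<alpha> \<Longrightarrow> m \<beta> = m' \<beta>\<close>[of \<zeta>]
        underS_subset_under[of \<kappa> \<delta>] under_mono[OF wo that(1)] by blast
    then show "starts m \<alpha> \<delta> = starts m' \<alpha> \<delta>"
      using that[of \<delta>] unfolding starts_def by auto
  qed
  define \<Psi> where "\<Psi> m \<alpha> = (if \<forall>\<beta>\<in>under \<kappa> \<alpha>. fst (m \<beta>) = topspace X then topspace X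
      else let g = f (THE \<delta>. starts m \<alpha> \<delta>) in \<Phi> (m \<circ> g) (inv_into (Field \<kappa>) g \<alpha>))"
    for m :: "'k \<Rightarrow> 'a set \<times> 'a" and \<alpha>
  have start: "\<exists>\<delta>. starts m \<alpha> \<delta> \<and> (THE \<delta>. starts m \<alpha> \<delta>) = \<delta>"
    if "\<not> (\<forall>\<beta>\<in>under \<kappa> \<alpha>. fst (m \<beta>) = topspace X)" for m :: "'k \<Rightarrow> 'a set \<times> 'a" and \<alpha>
  proof -
    have "\<exists>!\<delta>. starts m \<alpha> \<delta>"
      using that least_in_order[OF wo, where P = "\<lambda>\<beta>. fst (m \<beta>) \<noteq> topspace X"] unfolding starts_def by blast
    then show ?thesis by (metis the_equality)
  qed
  have later: "\<Psi> m (f \<delta> \<beta>) = \<Phi> (m \<circ> f \<delta>) \<beta>" if "\<delta> \<in> Field \<kappa>" "starts m \<delta> \<delta>" "\<beta> \<in> Field \<kappa>" for m \<delta> \<beta>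
  proof -
    have "f \<delta> \<beta> \<in> above \<kappa> \<delta>" using f(1)[OF that(1)] that(3) unfolding bij_betw_def by blast
    then have \<delta>: "\<delta> \<in> under \<kappa> (f \<delta> \<beta>)" by (simp add: above_def under_def)
    then have n: "\<not> (\<forall>\<zeta>\<in>under \<kappa> (f \<delta> \<beta>). fst (m \<zeta>) = topspace X)" and s: "starts m (f \<delta> \<beta>) \<delta>"
      using that(2) unfolding starts_def by blast+
    have "(THE \<delta>'. starts m (f \<delta> \<beta>) \<delta>') = \<delta>"
      using s least_in_order[OF wo \<delta>, where P = "\<lambda>\<beta>. fst (m \<beta>) \<noteq> topspace X"]
      unfolding starts_def by (intro the1_equality) blast+
    moreover have "inv_into (Field \<kappa>) (f \<delta>) (f \<delta> \<beta>) = \<beta>"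
      using f(1)[OF that(1)] that(3) unfolding bij_betw_def by simp
    ultimately show ?thesis using n by (auto simp: \<Psi>_def)
  qed
  have earlier: "\<Psi> m \<zeta> = topspace X" if "starts m \<delta> \<delta>" "\<zeta> \<in> underS \<kappa> \<delta>" for m \<delta> \<zeta>
    using that under_subset_underS[OF wo that(2)] unfolding \<Psi>_def starts_def by auto
  have "causal \<kappa> \<Psi>"
    unfolding causal_def
  proof (intro allI ballI impI)
    fix m m' :: "'k \<Rightarrow> 'a set \<times> 'a" and \<alpha>
    assume \<alpha>: "\<alpha> \<in> Field \<kappa>" and eq: "\<forall>\<beta>\<in>under \<kappa> \<alpha>. m \<beta> = m' \<beta>"
    show "\<Psi> m \<alpha> = \<Psi> m' \<alpha>"
    proof (cases "\<forall>\<beta>\<in>under \<kappa> \<alpha>. fst (m \<beta>) = topspace X")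
      case True
      then show ?thesis using eq by (simp add: \<Psi>_def)
    next
      case False
      obtain \<delta> where \<delta>: "starts m \<alpha> \<delta>" "(THE \<delta>. starts m \<alpha> \<delta>) = \<delta>" using start[OF False] by blast
      have F: "\<delta> \<in> Field \<kappa>" using \<delta>(1) under_in_Field(1)[of \<delta>] unfolding starts_def by blast
      have "starts m \<alpha> = starts m' \<alpha>" using starts_cong eq by blast
      then have \<delta>': "(THE \<delta>. starts m' \<alpha> \<delta>) = \<delta>" using \<delta> by simp
      have "\<alpha> \<in> above \<kappa> \<delta>" using \<delta>(1) unfolding starts_def under_def above_def by blast
      then obtain \<beta> where \<beta>: "\<beta> \<in> Field \<kappa>" "\<alpha> = f \<delta> \<beta>"
        using f(1)[OF F] unfolding bij_betw_def by blast
      have "\<Phi> (m \<circ> f \<delta>) \<beta> = \<Phi> (m' \<circ> f \<delta>) \<beta>"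
        using eq \<beta>(2) f(2)[OF F \<beta>(1)]
        by (intro causalD[OF winning_response_causal[OF win] \<beta>(1)]) auto
      moreover have "starts m \<delta> \<delta>" "starts m' \<delta> \<delta>"
        using \<delta>(1) \<open>starts m \<alpha> = starts m' \<alpha>\<close> in_under_self[OF wo F] unfolding starts_def fun_eq_iff by blast+
      ultimately show ?thesis using later[OF F _ \<beta>(1)] \<beta>(2) by simp
    qed
  qed
  have cur: "current_set \<kappa> X (\<Psi> m) (f \<delta> \<beta>) = current_set \<kappa> X (\<Phi> (m \<circ> f \<delta>)) \<beta>"
    if F: "\<delta> \<in> Field \<kappa>" and s: "starts m \<delta> \<delta>" and \<beta>: "\<beta> \<in> Field \<kappa>" for m \<delta> \<beta>
  proof -
    have *: "\<zeta> \<in> underS \<kappa> \<delta> \<or> \<zeta> \<in> f \<delta> ` underS \<kappa> \<beta>" if "\<zeta> \<in> underS \<kappa> (f \<delta> \<beta>)" for \<zeta>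
      using underS_or_above[OF wo under_in_Field(2)[OF that] F] that unfolding f(3)[OF F \<beta>] by blast
    have **: "f \<delta> ` underS \<kappa> \<beta> \<subseteq> underS \<kappa> (f \<delta> \<beta>)" using f(3)[OF F \<beta>] by blast
    have l: "\<Psi> m (f \<delta> \<zeta>) = \<Phi> (m \<circ> f \<delta>) \<zeta>" if "\<zeta> \<in> underS \<kappa> \<beta>" for \<zeta>
      using later[OF F s] that under_in_Field(2) by fast
    show ?thesis
    proof (intro equalityI subsetI)
      fix x assume "x \<in> current_set \<kappa> X (\<Psi> m) (f \<delta> \<beta>)"
      then show "x \<in> current_set \<kappa> X (\<Phi> (m \<circ> f \<delta>)) \<beta>"
        using l ** unfolding current_set_def by fast
    next
      fix x assume x: "x \<in> current_set \<kappa> X (\<Phi> (m \<circ> f \<delta>)) \<beta>"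
      have "x \<in> \<Psi> m \<zeta>" if "\<zeta> \<in> underS \<kappa> (f \<delta> \<beta>)" for \<zeta>
        using *[OF that] l earlier[OF s] x unfolding current_set_def by auto
      then show "x \<in> current_set \<kappa> X (\<Psi> m) (f \<delta> \<beta>)" using x unfolding current_set_def by auto
    qed
  qed
  have limit: "limit_round \<kappa> (f \<delta> \<gamma>)" if F: "\<delta> \<in> Field \<kappa>" and \<gamma>: "limit_round \<kappa> \<gamma>" for \<delta> \<gamma>
  proof -
    have \<gamma>F: "\<gamma> \<in> Field \<kappa>" using \<gamma> unfolding limit_round_def by blast
    have fF: "f \<delta> \<gamma> \<in> Field \<kappa>"
      using f(1)[OF F] \<gamma>F unfolding bij_betw_def above_def Field_def by blast
    have "\<exists>\<beta>\<in>underS \<kappa> (f \<delta> \<gamma>). \<alpha> \<in> underS \<kappa> \<beta>" if \<alpha>: "\<alpha> \<in> underS \<kappa> (f \<delta> \<gamma>)" for \<alpha>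
    proof (cases "\<alpha> \<in> underS \<kappa> \<delta>")
      case True
      obtain \<zeta> where "\<zeta> \<in> underS \<kappa> \<gamma>" using \<gamma> unfolding limit_round_def by blast
      then have "f \<delta> \<zeta> \<in> underS \<kappa> (f \<delta> \<gamma>) \<inter> above \<kappa> \<delta>" using f(3)[OF F \<gamma>F] by blast
      moreover from this have "\<alpha> \<in> underS \<kappa> (f \<delta> \<zeta>)"
        using True underS_mono[OF wo, of \<delta> "f \<delta> \<zeta>"] unfolding above_def under_def by blast
      ultimately show ?thesis by blast
    next
      case False
      then have "\<alpha> \<in> above \<kappa> \<delta>"
        using underS_or_above[OF wo under_in_Field(2)[OF \<alpha>] F] by blast
      then obtain \<zeta> where \<zeta>: "\<zeta> \<in> underS \<kappa> \<gamma>" "\<alpha> = f \<delta> \<zeta>" using f(3)[OF F \<gamma>F] \<alpha> by blast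
      then obtain \<xi> where \<xi>: "\<xi> \<in> underS \<kappa> \<gamma>" "\<zeta> \<in> underS \<kappa> \<xi>" using \<gamma> unfolding limit_round_def by blast
      then show ?thesis
        using f(3)[OF F \<gamma>F] f(3)[OF F under_in_Field(2)[OF \<xi>(1)]] \<zeta>(2) by blast
    qed
    moreover have "underS \<kappa> (f \<delta> \<gamma>) \<noteq> {}"
      using f(3)[OF F \<gamma>F] \<gamma> unfolding limit_round_def by blast
    ultimately show ?thesis using fF unfolding limit_round_def by blast
  qed
  have sound: "sound_round \<kappa> X (m \<circ> f \<delta>) (\<Phi> (m \<circ> f \<delta>)) \<beta>"
    if F: "\<delta> \<in> Field \<kappa>" and s: "starts m \<delta> \<delta>" and \<beta>: "\<beta> \<in> Field \<kappa>"
      and snd: "sound_round \<kappa> X m (\<Psi> m) (f \<delta> \<beta>)" for m \<delta> \<beta>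
  proof -
    have "round_reached \<kappa> X (\<Phi> (m \<circ> f \<delta>)) \<beta>"
      unfolding round_reached_def
    proof (intro ballI impI)
      fix \<gamma> assume \<gamma>: "\<gamma> \<in> under \<kappa> \<beta>" "limit_round \<kappa> \<gamma>"
      then have "f \<delta> \<gamma> \<in> under \<kappa> (f \<delta> \<beta>)" using f(2)[OF F \<beta>] by blast
      then have "current_set \<kappa> X (\<Psi> m) (f \<delta> \<gamma>) \<noteq> {}"
        using snd limit[OF F \<gamma>(2)] unfolding sound_round_def round_reached_def by blast
      then show "current_set \<kappa> X (\<Phi> (m \<circ> f \<delta>)) \<gamma> \<noteq> {}"
        using cur[OF F s under_in_Field(1)[OF \<gamma>(1)]] by simp
    qed
    then show ?thesis using snd cur[OF F s \<beta>] unfolding sound_round_def by simp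
  qed
  have "winning_response \<kappa> X \<Psi>"
  proof (rule winning_responseI[OF \<open>causal \<kappa> \<Psi>\<close>])
    fix m \<alpha> assume \<alpha>: "\<alpha> \<in> Field \<kappa>" and snd: "\<And>\<beta>. \<beta> \<in> under \<kappa> \<alpha> \<Longrightarrow> sound_round \<kappa> X m (\<Psi> m) \<beta>"
    have self: "\<alpha> \<in> under \<kappa> \<alpha>" using in_under_self[OF wo \<alpha>] .
    show "openin X (\<Psi> m \<alpha>) \<and> snd (m \<alpha>) \<in> \<Psi> m \<alpha> \<and> \<Psi> m \<alpha> \<inter> current_set \<kappa> X (\<Psi> m) \<alpha> \<subseteq> fst (m \<alpha>)"
    proof (cases "\<forall>\<beta>\<in>under \<kappa> \<alpha>. fst (m \<beta>) = topspace X")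
      case True
      then show ?thesis using self snd[OF self] unfolding \<Psi>_def sound_round_def by auto
    next
      case False
      obtain \<delta> where \<delta>: "starts m \<alpha> \<delta>" using start[OF False] by blast
      have F: "\<delta> \<in> Field \<kappa>" using \<delta>(1) under_in_Field(1)[of \<delta>] unfolding starts_def by blast
      have s: "starts m \<delta> \<delta>" using \<delta>(1) in_under_self[OF wo F] unfolding starts_def by blast
      have "\<alpha> \<in> above \<kappa> \<delta>" using \<delta>(1) unfolding starts_def under_def above_def by blast
      then obtain \<beta> where \<beta>: "\<beta> \<in> Field \<kappa>" "\<alpha> = f \<delta> \<beta>"
        using f(1)[OF F] unfolding bij_betw_def by blast
      have "sound_round \<kappa> X (m \<circ> f \<delta>) (\<Phi> (m \<circ> f \<delta>)) \<zeta>" if "\<zeta> \<in> under \<kappa> \<beta>" for \<zeta>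
        using that snd f(2)[OF F \<beta>(1)] \<beta>(2) by (intro sound[OF F s under_in_Field(1)[OF that]]) blast
      note D = winning_responseD[where m = "m \<circ> f \<delta>", OF win \<beta>(1) this]
      have e: "m (f \<delta> \<beta>) = (m \<circ> f \<delta>) \<beta>" by simp
      show ?thesis
        using D unfolding \<beta>(2) later[OF F s \<beta>(1)] cur[OF F s \<beta>(1)] e by blast
    qed
  next
    fix m assume snd: "\<And>\<alpha>. \<alpha> \<in> Field \<kappa> \<Longrightarrow> sound_round \<kappa> X m (\<Psi> m) \<alpha>"
    show "\<exists>x\<in>topspace X. \<forall>\<alpha>\<in>Field \<kappa>. x \<in> \<Psi> m \<alpha>"
    proof (cases "\<forall>\<beta>\<in>Field \<kappa>. fst (m \<beta>) = topspace X")
      case True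
      then have "\<forall>\<beta>\<in>under \<kappa> \<alpha>. fst (m \<beta>) = topspace X" for \<alpha>
        using under_in_Field(1)[of _ \<kappa> \<alpha>] by blast
      then have "\<Psi> m \<alpha> = topspace X" for \<alpha> by (simp add: \<Psi>_def)
      moreover obtain \<alpha> where "\<alpha> \<in> Field \<kappa>" using inf by fastforce
      ultimately show ?thesis using snd[of \<alpha>] unfolding sound_round_def current_set_def by auto
    next
      case False
      then obtain \<alpha> where "\<alpha> \<in> Field \<kappa>" "fst (m \<alpha>) \<noteq> topspace X" by blast
      then have "\<not> (\<forall>\<beta>\<in>under \<kappa> \<alpha>. fst (m \<beta>) = topspace X)" using in_under_self[OF wo] by blast
      then obtain \<delta> where \<delta>: "starts m \<alpha> \<delta>" using start by blast
      have F: "\<delta> \<in> Field \<kappa>" using \<delta>(1) under_in_Field(1)[of \<delta>] unfolding starts_def by blast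
      have s: "starts m \<delta> \<delta>" using \<delta>(1) in_under_self[OF wo F] unfolding starts_def by blast
      have img: "f \<delta> ` Field \<kappa> = above \<kappa> \<delta>" using f(1)[OF F] unfolding bij_betw_def by blast
      then have "sound_round \<kappa> X (m \<circ> f \<delta>) (\<Phi> (m \<circ> f \<delta>)) \<beta>" if "\<beta> \<in> Field \<kappa>" for \<beta>
        using that img by (intro sound[OF F s that] snd) (auto simp: above_def intro: FieldI2)
      from winning_response_wins[OF win this]
      obtain x where x: "x \<in> topspace X" "\<forall>\<beta>\<in>Field \<kappa>. x \<in> \<Phi> (m \<circ> f \<delta>) \<beta>" by blast
      have "x \<in> \<Psi> m \<zeta>" if "\<zeta> \<in> Field \<kappa>" for \<zeta>
      proof (cases "\<zeta> \<in> underS \<kappa> \<delta>")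
        case True
        then show ?thesis using earlier[OF s] x(1) by simp
      next
        case False
        then have "\<zeta> \<in> above \<kappa> \<delta>"
          using underS_or_above[OF wo that F] by blast
        then show ?thesis using img later[OF F s] x(2) by force
      qed
      then show ?thesis using x(1) by blast
    qed
  qed
  moreover have "patient \<kappa> X \<Psi>" unfolding patient_def \<Psi>_def by simp
  ultimately show ?thesis by blast
qed

section \<open>The game on subspaces\<close>

text \<open>II imagines a game in \<open>X\<close> in which the move of I in round \<open>\<alpha>\<close> is extended from \<open>S\<close> to \<open>X\<close> and then cut
  down to \<open>W \<alpha>\<close>, and answers with the trace on \<open>S\<close> of the reply. The running intersection in \<open>S\<close> is the
  trace of the one in \<open>X\<close>, so the imagined run survives every limit that the actual one survives. A
  point common to all replies in \<open>X\<close> lies in every \<open>W \<alpha>\<close>, hence in \<open>S\<close>.\<close>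

lemma winning_response_Gdelta:
  assumes wo: "Well_order \<kappa>" and win: "winning_response \<kappa> X \<Phi>"
    and G: "Gdelta_set \<kappa> X S"
  shows "\<exists>\<Psi>. winning_response \<kappa> (subtopology X S) \<Psi>"
proof -
  obtain W where W: "\<And>\<alpha>. \<alpha> \<in> Field \<kappa> \<Longrightarrow> openin X (W \<alpha>)" and S: "S = (\<Inter>\<alpha>\<in>Field \<kappa>. W \<alpha>)"
    using G unfolding Gdelta_set_def by blast
  let ?Y = "subtopology X S"
  define lift where "lift U = (SOME O'. openin X O' \<and> U = O' \<inter> S)" for U
  have lift: "openin X (lift U) \<and> U = lift U \<inter> S" if "openin ?Y U" for U
    unfolding lift_def by (rule someI_ex) (use that in \<open>simp add: openin_subtopology\<close>)
  define t where "t m \<alpha> = (lift (fst (m \<alpha>)) \<inter> W \<alpha>, snd (m \<alpha>))"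
    for m :: "'a \<Rightarrow> 'b set \<times> 'b" and \<alpha>
  define \<Psi> where "\<Psi> m \<alpha> = \<Phi> (t m) \<alpha> \<inter> S" for m \<alpha>
  have cur: "current_set \<kappa> ?Y (\<Psi> m) \<alpha> = S \<inter> current_set \<kappa> X (\<Phi> (t m)) \<alpha>" for m \<alpha>
    unfolding current_set_def \<Psi>_def by auto
  have sound: "sound_round \<kappa> X (t m) (\<Phi> (t m)) \<alpha> \<and> fst (m \<alpha>) = lift (fst (m \<alpha>)) \<inter> S"
    if \<alpha>: "\<alpha> \<in> Field \<kappa>" and snd: "sound_round \<kappa> ?Y m (\<Psi> m) \<alpha>" for m \<alpha>
  proof -
    have "round_reached \<kappa> X (\<Phi> (t m)) \<alpha>"
      using snd cur unfolding sound_round_def round_reached_def by blast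
    moreover have "openin ?Y (fst (m \<alpha>))" using snd unfolding sound_round_def by blast
    note l = lift[OF this]
    moreover have "snd (m \<alpha>) \<in> fst (m \<alpha>)" "snd (m \<alpha>) \<in> S \<inter> current_set \<kappa> X (\<Phi> (t m)) \<alpha>"
      using snd unfolding sound_round_def cur by blast+
    moreover have "S \<subseteq> W \<alpha>" using \<alpha> unfolding S by blast
    moreover have "openin X (lift (fst (m \<alpha>)) \<inter> W \<alpha>)" using l W[OF \<alpha>] by (blast intro: openin_Int)
    ultimately show ?thesis
      unfolding sound_round_def t_def fst_conv snd_conv by blast
  qed
  have "winning_response \<kappa> ?Y \<Psi>"
  proof (rule winning_responseI)
    show "causal \<kappa> \<Psi>"
      unfolding causal_def \<Psi>_def
    proof (intro allI ballI impI)
      fix m m' :: "'a \<Rightarrow> 'b set \<times> 'b" and \<alpha>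
      assume "\<alpha> \<in> Field \<kappa>" "\<forall>\<beta>\<in>under \<kappa> \<alpha>. m \<beta> = m' \<beta>"
      then have "\<Phi> (t m) \<alpha> = \<Phi> (t m') \<alpha>"
        by (intro causalD[OF winning_response_causal[OF win]]) (auto simp: t_def)
      then show "\<Phi> (t m) \<alpha> \<inter> S = \<Phi> (t m') \<alpha> \<inter> S" by simp
    qed
  next
    fix m \<alpha> assume \<alpha>: "\<alpha> \<in> Field \<kappa>" and snd: "\<And>\<beta>. \<beta> \<in> under \<kappa> \<alpha> \<Longrightarrow> sound_round \<kappa> ?Y m (\<Psi> m) \<beta>"
    have self: "\<alpha> \<in> under \<kappa> \<alpha>" using in_under_self[OF wo \<alpha>] .
    have "sound_round \<kappa> X (t m) (\<Phi> (t m)) \<beta>" if "\<beta> \<in> under \<kappa> \<alpha>" for \<beta>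
      using sound[OF under_in_Field(1)[OF that] snd[OF that]] by blast
    note D = winning_responseD[where m = "t m", OF win \<alpha> this]
    have "snd (m \<alpha>) \<in> S" using snd[OF self] unfolding sound_round_def cur by blast
    then show "openin ?Y (\<Psi> m \<alpha>) \<and> snd (m \<alpha>) \<in> \<Psi> m \<alpha> \<and> \<Psi> m \<alpha> \<inter> current_set \<kappa> ?Y (\<Psi> m) \<alpha> \<subseteq> fst (m \<alpha>)"
      using D sound[OF \<alpha> snd[OF self]] unfolding \<Psi>_def[of m \<alpha>] cur t_def[of m \<alpha>] fst_conv snd_conv openin_subtopology
      by blast
  next
    fix m assume snd: "\<And>\<alpha>. \<alpha> \<in> Field \<kappa> \<Longrightarrow> sound_round \<kappa> ?Y m (\<Psi> m) \<alpha>"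
    have s: "sound_round \<kappa> X (t m) (\<Phi> (t m)) \<alpha>" if "\<alpha> \<in> Field \<kappa>" for \<alpha>
      using sound[OF that snd[OF that]] by blast
    from winning_response_wins[where m = "t m", OF win s]
    obtain x where x: "x \<in> topspace X" "\<forall>\<alpha>\<in>Field \<kappa>. x \<in> \<Phi> (t m) \<alpha>" by blast
    have "x \<in> W \<alpha>" if \<alpha>: "\<alpha> \<in> Field \<kappa>" for \<alpha>
    proof -
      have "\<Phi> (t m) \<alpha> \<inter> current_set \<kappa> X (\<Phi> (t m)) \<alpha> \<subseteq> fst (t m \<alpha>)"
        by (rule winning_responseD(3)[OF win \<alpha>]) (rule s[OF under_in_Field(1)])
      moreover have "x \<in> current_set \<kappa> X (\<Phi> (t m)) \<alpha>"
        using x under_in_Field(2)[of _ \<kappa> \<alpha>] unfolding current_set_def by blast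
      ultimately show ?thesis using x(2) \<alpha> unfolding t_def[of m \<alpha>] fst_conv by blast
    qed
    then have "x \<in> S" unfolding S by blast
    then show "\<exists>x\<in>topspace ?Y. \<forall>\<alpha>\<in>Field \<kappa>. x \<in> \<Psi> m \<alpha>"
      using x unfolding \<Psi>_def topspace_subtopology by blast
  qed
  then show ?thesis by (intro exI)
qed

section \<open>The game on sums\<close>

lemma least_round_exists:
  assumes wo: "Well_order \<kappa>" and ne: "Field \<kappa> \<noteq> {}"
  shows "\<exists>z\<in>Field \<kappa>. \<forall>\<alpha>\<in>Field \<kappa>. z \<in> under \<kappa> \<alpha>"
proof -
  obtain \<alpha> where "\<alpha> \<in> Field \<kappa>" using ne by blast
  then obtain z where z: "z \<in> under \<kappa> \<alpha>" "\<forall>\<zeta>\<in>underS \<kappa> z. \<not> True"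
    using least_in_order[OF wo in_under_self[OF wo], where P = "\<lambda>_. True"] by blast
  then have "z \<in> under \<kappa> \<beta>" if "\<beta> \<in> Field \<kappa>" for \<beta>
    using underS_or_above[OF wo that under_in_Field(1)[OF z(1)]] unfolding above_def under_def by blast
  then show ?thesis using under_in_Field(1)[OF z(1)] by blast
qed

text \<open>The first point that I plays selects a summand, and II plays the whole game there.\<close>

lemma winning_response_sum:
  fixes \<kappa> :: "'k rel" and X :: "'i \<Rightarrow> 'a topology"
  assumes wo: "Well_order \<kappa>" and ne: "Field \<kappa> \<noteq> {}"
    and win: "\<And>i. i \<in> I \<Longrightarrow> winning_response \<kappa> (X i) (\<Phi> i)"
  shows "\<exists>\<Psi>. winning_response \<kappa> (sum_topology X I) \<Psi>"
proof -
  let ?Y = "sum_topology X I"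
  obtain z where z: "z \<in> Field \<kappa>" "\<And>\<alpha>. \<alpha> \<in> Field \<kappa> \<Longrightarrow> z \<in> under \<kappa> \<alpha>"
    using least_round_exists[OF wo ne] by blast
  \<comment> \<open>The selected summand. The moves \<open>t m\<close> are the slices of I's moves in it; the
    parts of I's open sets that lie in other summands are dropped.\<close>
  define s where "s m = fst (snd (m z))" for m :: "'k \<Rightarrow> ('i \<times> 'a) set \<times> 'i \<times> 'a"
  define t where "t m \<alpha> = ({x. (s m, x) \<in> fst (m \<alpha>)}, snd (snd (m \<alpha>)))"
    for m :: "'k \<Rightarrow> ('i \<times> 'a) set \<times> 'i \<times> 'a" and \<alpha>
  define \<Psi> where "\<Psi> m \<alpha> = (if s m \<in> I then {s m} \<times> \<Phi> (s m) (t m) \<alpha> else {})" for m \<alpha>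
  have top: "topspace ?Y = Sigma I (\<lambda>i. topspace (X i))" by (simp add: o_def)
  have sI: "s m \<in> I" if "sound_round \<kappa> ?Y m (\<Psi> m) z" for m
  proof -
    have "snd (m z) \<in> topspace ?Y" using that unfolding sound_round_def current_set_def by blast
    then show ?thesis unfolding top s_def by auto
  qed
  have cur: "(s m, x) \<in> current_set \<kappa> ?Y (\<Psi> m) \<alpha> \<longleftrightarrow> x \<in> current_set \<kappa> (X (s m)) (\<Phi> (s m) (t m)) \<alpha>"
    if "s m \<in> I" for m x \<alpha>
    using that unfolding current_set_def \<Psi>_def top by auto
  have fst_cur: "fst p = s m" if "p \<in> current_set \<kappa> ?Y (\<Psi> m) \<alpha>" "\<alpha> \<in> Field \<kappa>" "\<alpha> \<noteq> z" for p m \<alpha>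
  proof -
    have "z \<in> underS \<kappa> \<alpha>" using z(2)[OF that(2)] that(3) under_cases by fast
    then have "p \<in> \<Psi> m z" using that(1) unfolding current_set_def by blast
    then show ?thesis unfolding \<Psi>_def by (auto split: if_splits)
  qed
  have sound: "sound_round \<kappa> (X (s m)) (t m) (\<Phi> (s m) (t m)) \<alpha> \<and> fst (snd (m \<alpha>)) = s m"
    if \<alpha>: "\<alpha> \<in> Field \<kappa>" and sI: "s m \<in> I" and snd: "sound_round \<kappa> ?Y m (\<Psi> m) \<alpha>" for m \<alpha>
  proof -
    have eq: "fst (snd (m \<alpha>)) = s m"
      using fst_cur[of "snd (m \<alpha>)" m \<alpha>] snd \<alpha> unfolding sound_round_def s_def by blast
    then have p: "snd (m \<alpha>) = (s m, snd (snd (m \<alpha>)))" by (simp add: prod_eq_iff)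
    have "round_reached \<kappa> (X (s m)) (\<Phi> (s m) (t m)) \<alpha>"
      unfolding round_reached_def
    proof (intro ballI impI)
      fix \<gamma> assume \<gamma>: "\<gamma> \<in> under \<kappa> \<alpha>" "limit_round \<kappa> \<gamma>"
      then obtain p where p: "p \<in> current_set \<kappa> ?Y (\<Psi> m) \<gamma>"
        using snd unfolding sound_round_def round_reached_def by blast
      have "\<gamma> \<noteq> z"
      proof
        assume "\<gamma> = z"
        then obtain \<zeta> where \<zeta>: "\<zeta> \<in> underS \<kappa> z" using \<gamma>(2) unfolding limit_round_def by blast
        then show False
          using z(2)[OF under_in_Field(2)[OF \<zeta>]] well_order_laws(2)[OF wo, of \<zeta> z]
          unfolding underS_def under_def by blast
      qed
      then have "fst p = s m" using fst_cur[OF p under_in_Field(1)[OF \<gamma>(1)]] by blast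
      then have "(s m, snd p) \<in> current_set \<kappa> ?Y (\<Psi> m) \<gamma>" using p by (metis prod.collapse)
      then show "current_set \<kappa> (X (s m)) (\<Phi> (s m) (t m)) \<gamma> \<noteq> {}" using cur[OF sI] by blast
    qed
    moreover have "openin (X (s m)) (fst (t m \<alpha>))"
      using snd sI unfolding sound_round_def openin_sum_topology t_def by simp
    moreover have "(s m, snd (snd (m \<alpha>))) \<in> fst (m \<alpha>)"
      "(s m, snd (snd (m \<alpha>))) \<in> current_set \<kappa> ?Y (\<Psi> m) \<alpha>"
      using snd unfolding sound_round_def p[symmetric] by blast+
    ultimately show ?thesis
      using eq cur[OF sI] unfolding sound_round_def t_def by simp
  qed
  have "winning_response \<kappa> ?Y \<Psi>"
  proof (rule winning_responseI)
    show "causal \<kappa> \<Psi>"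
      unfolding causal_def
    proof (intro allI ballI impI)
      fix m m' :: "'k \<Rightarrow> ('i \<times> 'a) set \<times> 'i \<times> 'a" and \<alpha>
      assume \<alpha>: "\<alpha> \<in> Field \<kappa>" and eq: "\<forall>\<beta>\<in>under \<kappa> \<alpha>. m \<beta> = m' \<beta>"
      have s: "s m = s m'" using eq z(2)[OF \<alpha>] unfolding s_def by simp
      have "\<Phi> (s m) (t m) \<alpha> = \<Phi> (s m) (t m') \<alpha>" if "s m \<in> I"
        using eq s by (intro causalD[OF winning_response_causal[OF win[OF that]] \<alpha>]) (auto simp: t_def)
      then show "\<Psi> m \<alpha> = \<Psi> m' \<alpha>" using s by (simp add: \<Psi>_def)
    qed
  next
    fix m \<alpha> assume \<alpha>: "\<alpha> \<in> Field \<kappa>" and snd: "\<And>\<beta>. \<beta> \<in> under \<kappa> \<alpha> \<Longrightarrow> sound_round \<kappa> ?Y m (\<Psi> m) \<beta>"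
    have self: "\<alpha> \<in> under \<kappa> \<alpha>" using in_under_self[OF wo \<alpha>] .
    have sI: "s m \<in> I" using sI[OF snd[OF z(2)[OF \<alpha>]]] .
    have "sound_round \<kappa> (X (s m)) (t m) (\<Phi> (s m) (t m)) \<beta>" if "\<beta> \<in> under \<kappa> \<alpha>" for \<beta>
      using sound[OF under_in_Field(1)[OF that] sI snd[OF that]] by blast
    note D = winning_responseD[where m = "t m", OF win[OF sI] \<alpha> this]
    have \<Psi>: "\<Psi> m \<alpha> = {s m} \<times> \<Phi> (s m) (t m) \<alpha>" using sI by (simp add: \<Psi>_def)
    have "openin ?Y (\<Psi> m \<alpha>)"
      unfolding openin_sum_topology
    proof (intro conjI ballI)
      show "\<Psi> m \<alpha> \<subseteq> Sigma I (topspace \<circ> X)" using openin_subset[OF D(1)] sI unfolding \<Psi> by auto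
      show "openin (X i) {x. (i, x) \<in> \<Psi> m \<alpha>}" for i using D(1) unfolding \<Psi> by (cases "i = s m") auto
    qed
    moreover have "snd (m \<alpha>) \<in> \<Psi> m \<alpha>"
      using D(2) sound[OF \<alpha> sI snd[OF self]] unfolding \<Psi> t_def by (auto simp: mem_Times_iff)
    moreover have "\<Psi> m \<alpha> \<inter> current_set \<kappa> ?Y (\<Psi> m) \<alpha> \<subseteq> fst (m \<alpha>)"
    proof
      fix p assume p: "p \<in> \<Psi> m \<alpha> \<inter> current_set \<kappa> ?Y (\<Psi> m) \<alpha>"
      then obtain x where x: "p = (s m, x)" "x \<in> \<Phi> (s m) (t m) \<alpha>" unfolding \<Psi> by auto
      then have "x \<in> fst (t m \<alpha>)" using p cur[OF sI] D(3) by blast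
      then show "p \<in> fst (m \<alpha>)" using x(1) unfolding t_def by simp
    qed
    ultimately show "openin ?Y (\<Psi> m \<alpha>) \<and> snd (m \<alpha>) \<in> \<Psi> m \<alpha> \<and> \<Psi> m \<alpha> \<inter> current_set \<kappa> ?Y (\<Psi> m) \<alpha> \<subseteq> fst (m \<alpha>)"
      by blast
  next
    fix m assume snd: "\<And>\<alpha>. \<alpha> \<in> Field \<kappa> \<Longrightarrow> sound_round \<kappa> ?Y m (\<Psi> m) \<alpha>"
    have sI: "s m \<in> I" using sI[OF snd[OF z(1)]] .
    have "sound_round \<kappa> (X (s m)) (t m) (\<Phi> (s m) (t m)) \<alpha>" if "\<alpha> \<in> Field \<kappa>" for \<alpha>
      using sound[OF that sI snd[OF that]] by blast
    from winning_response_wins[where m = "t m", OF win[OF sI] this]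
    obtain x where x: "x \<in> topspace (X (s m))" "\<forall>\<alpha>\<in>Field \<kappa>. x \<in> \<Phi> (s m) (t m) \<alpha>" by blast
    then have "(s m, x) \<in> topspace ?Y" "\<forall>\<alpha>\<in>Field \<kappa>. (s m, x) \<in> \<Psi> m \<alpha>"
      using sI unfolding top \<Psi>_def by auto
    then show "\<exists>x\<in>topspace ?Y. \<forall>\<alpha>\<in>Field \<kappa>. x \<in> \<Psi> m \<alpha>" by blast
  qed
  then show ?thesis by (intro exI)
qed

section \<open>Small boxes in products\<close>

lemma admissible_cardinalD:
  assumes "admissible_cardinal \<kappa>"
  shows "Card_order \<kappa>" "Well_order \<kappa>" "infinite (Field \<kappa>)"
    "|binary_seqs_below \<kappa>| \<le>o \<kappa>"
    "|A| <o \<kappa> \<Longrightarrow> (\<And>a. a \<in> A \<Longrightarrow> |F a| <o \<kappa>) \<Longrightarrow> |\<Union>a\<in>A. F a| <o \<kappa>"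
proof -
  show card: "Card_order \<kappa>" using assms unfolding admissible_cardinal_def by blast
  then show "Well_order \<kappa>" by (rule card_order_on_well_order_on)
  have "natLeq \<le>o |Field \<kappa>|"
    using assms card_of_Field_ordIso[OF card] ordIso_symmetric ordLess_imp_ordLeq ordLeq_ordIso_trans
    unfolding admissible_cardinal_def by blast
  then show inf: "infinite (Field \<kappa>)" using infinite_iff_natLeq_ordLeq by blast
  show "|binary_seqs_below \<kappa>| \<le>o \<kappa>"
    using assms ordIso_imp_ordLeq unfolding admissible_cardinal_def by blast
  show "|A| <o \<kappa> \<Longrightarrow> (\<And>a. a \<in> A \<Longrightarrow> |F a| <o \<kappa>) \<Longrightarrow> |\<Union>a\<in>A. F a| <o \<kappa>"
    using assms card inf unfolding admissible_cardinal_def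
    by (intro card_of_UNION_ordLess_infinite_Field_regularCard) (auto simp: cinfinite_def)
qed

lemma card_of_under_less:
  assumes card: "Card_order \<kappa>" and inf: "infinite (Field \<kappa>)" and \<alpha>: "\<alpha> \<in> Field \<kappa>"
  shows "|under \<kappa> \<alpha>| <o \<kappa>"
proof -
  have wo: "Well_order \<kappa>" using card by (rule card_order_on_well_order_on)
  obtain \<beta> where \<beta>: "\<beta> \<in> Field \<kappa>" "\<alpha> \<noteq> \<beta>" "(\<alpha>, \<beta>) \<in> \<kappa>"
    using infinite_Card_order_limit[OF card inf \<alpha>] by blast
  then have "\<alpha> \<in> underS \<kappa> \<beta>" by (simp add: underS_def)
  then have "|under \<kappa> \<alpha>| \<le>o |underS \<kappa> \<beta>|"
    by (intro card_of_mono1 under_subset_underS[OF wo])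
  then show ?thesis using card_of_underS[OF card \<beta>(1)] ordLeq_ordLess_trans by blast
qed

lemma finite_card_less:
  assumes "Card_order \<kappa>" "infinite (Field \<kappa>)" "finite A"
  shows "|A| <o \<kappa>"
  using assms card_order_on_well_order_on[OF assms(1)]
  by (intro finite_ordLess_infinite) (auto simp: Field_card_of card_of_well_order_on)

definition small_box :: "'k rel \<Rightarrow> ('i \<Rightarrow> 'a topology) \<Rightarrow> 'i set \<Rightarrow> ('i \<Rightarrow> 'a set) \<Rightarrow> bool" where
  "small_box \<kappa> X I U \<longleftrightarrow>
     (\<forall>i\<in>I. openin (X i) (U i)) \<and> |{i\<in>I. U i \<noteq> topspace (X i)}| <o \<kappa>"

lemma small_box_Int:
  assumes adm: "admissible_cardinal \<kappa>" and "small_box \<kappa> X I U" "small_box \<kappa> X I V"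
  shows "small_box \<kappa> X I (\<lambda>i. U i \<inter> V i)"
proof -
  have "|{i\<in>I. U i \<inter> V i \<noteq> topspace (X i)}| \<le>o |{i\<in>I. U i \<noteq> topspace (X i)} \<union> {i\<in>I. V i \<noteq> topspace (X i)}|"
    by (rule card_of_mono1) auto
  also have "|{i\<in>I. U i \<noteq> topspace (X i)} \<union> {i\<in>I. V i \<noteq> topspace (X i)}| <o \<kappa>"
    using assms(2,3) unfolding small_box_def
    by (intro card_of_Un_ordLess_infinite_Field[OF admissible_cardinalD(3,1)[OF adm]]) blast+
  finally show ?thesis using assms(2,3) unfolding small_box_def by (blast intro: openin_Int)
qed

lemma small_box_topspace:
  assumes "admissible_cardinal \<kappa>"
  shows "small_box \<kappa> X I (\<lambda>i. topspace (X i))"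
  using finite_card_less[OF admissible_cardinalD(1,3)[OF assms], of "{}"]
  unfolding small_box_def by simp

lemma openin_small_box:
  "small_box \<kappa> X I U \<Longrightarrow> openin (lt_supported_product_topology \<kappa> X I) (PiE I U)"
  unfolding lt_supported_product_topology_def small_box_def by (rule topology_generated_by_Basis) blast

text \<open>Boxes of small support are closed under finite intersections because the support of an
  intersection lies in the union of the supports; so they form a base and not only a subbase.\<close>

lemma small_box_in_open:
  assumes adm: "admissible_cardinal \<kappa>"
    and "openin (lt_supported_product_topology \<kappa> X I) W" "x \<in> W"
  shows "\<exists>U. small_box \<kappa> X I U \<and> x \<in> PiE I U \<and> PiE I U \<subseteq> W"
proof -
  have "generate_topology_on {PiE I U |U. small_box \<kappa> X I U} W"
    using assms(2) unfolding lt_supported_product_topology_def small_box_def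
    by (rule openin_topology_generated_by)
  then show ?thesis using assms(3)
  proof (induction arbitrary: x)
    case Empty
    then show ?case by simp
  next
    case (Int A B)
    have x: "x \<in> A" "x \<in> B" using Int.prems by auto
    obtain U where U: "small_box \<kappa> X I U" "x \<in> PiE I U" "PiE I U \<subseteq> A"
      using Int.IH(1)[OF x(1)] by auto
    obtain V where V: "small_box \<kappa> X I V" "x \<in> PiE I V" "PiE I V \<subseteq> B"
      using Int.IH(2)[OF x(2)] by auto
    have "PiE I (\<lambda>i. U i \<inter> V i) = PiE I U \<inter> PiE I V" by (rule PiE_Int[symmetric])
    then show ?case
      using U V small_box_Int[OF adm U(1) V(1)] by (intro exI[of _ "\<lambda>i. U i \<inter> V i"]) blast
  next
    case (UN K)
    then obtain k where k: "k \<in> K" "x \<in> k" by blast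
    from UN.IH[OF this] show ?case using k(1) by blast
  next
    case (Basis S)
    then show ?case by blast
  qed
qed

lemma topspace_lt_supported_product:
  assumes adm: "admissible_cardinal \<kappa>"
  shows "topspace (lt_supported_product_topology \<kappa> X I) = PiE I (\<lambda>i. topspace (X i))"
proof
  show "PiE I (\<lambda>i. topspace (X i)) \<subseteq> topspace (lt_supported_product_topology \<kappa> X I)"
    by (rule openin_subset[OF openin_small_box[OF small_box_topspace[OF adm]]])
  show "topspace (lt_supported_product_topology \<kappa> X I) \<subseteq> PiE I (\<lambda>i. topspace (X i))"
  proof
    fix x assume "x \<in> topspace (lt_supported_product_topology \<kappa> X I)"
    from small_box_in_open[OF adm openin_topspace this]
    obtain U where U: "small_box \<kappa> X I U" "x \<in> PiE I U" by blast
    then have "U i \<subseteq> topspace (X i)" if "i \<in> I" for i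
      using that openin_subset unfolding small_box_def by blast
    then show "x \<in> PiE I (\<lambda>i. topspace (X i))" using U(2) by (blast intro: subsetD[OF PiE_mono])
  qed
qed

section \<open>The game on products\<close>

text \<open>II shrinks the move of I to a box of small support around the point and plays the coordinate games
  in parallel, each by a patient response. A coordinate outside the supports of all boxes so far has
  only seen the whole factor, so its reply is still the whole factor. Hence the support of the
  combined reply in round \<open>\<alpha>\<close> is contained in the union of the supports of the boxes of the rounds up to \<open>\<alpha>\<close>;
  these are fewer than \<open>\<kappa>\<close> many sets of size less than \<open>\<kappa>\<close>, and by regularity their union is small. The
  running intersection is the product of the coordinatewise ones, so each coordinate run survives
  whenever the actual run does.\<close>

lemma winning_response_product:
  fixes \<kappa> :: "'k rel" and X :: "'i \<Rightarrow> 'a topology"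
  assumes adm: "admissible_cardinal \<kappa>"
    and win: "\<And>i. i \<in> I \<Longrightarrow> winning_response \<kappa> (X i) (\<Phi> i)"
    and pat: "\<And>i. i \<in> I \<Longrightarrow> patient \<kappa> (X i) (\<Phi> i)"
  shows "\<exists>\<Psi>. winning_response \<kappa> (lt_supported_product_topology \<kappa> X I) \<Psi>"
proof -
  let ?Y = "lt_supported_product_topology \<kappa> X I"
  note card = admissible_cardinalD(1)[OF adm] and wo = admissible_cardinalD(2)[OF adm]
    and inf = admissible_cardinalD(3)[OF adm]
  have top: "topspace ?Y = PiE I (\<lambda>i. topspace (X i))" by (rule topspace_lt_supported_product[OF adm])
  define box where "box p = (SOME U. small_box \<kappa> X I U \<and> snd p \<in> PiE I U \<and> PiE I U \<subseteq> fst p)"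
    for p :: "('i \<Rightarrow> 'a) set \<times> ('i \<Rightarrow> 'a)"
  define c where "c i m \<alpha> = (box (m \<alpha>) i, snd (m \<alpha>) i)"
    for i and m :: "'k \<Rightarrow> ('i \<Rightarrow> 'a) set \<times> ('i \<Rightarrow> 'a)" and \<alpha>
  define \<Psi> where "\<Psi> m \<alpha> = PiE I (\<lambda>i. \<Phi> i (c i m) \<alpha>)" for m \<alpha>
  have box: "small_box \<kappa> X I (box (m \<alpha>)) \<and> snd (m \<alpha>) \<in> PiE I (box (m \<alpha>)) \<and> PiE I (box (m \<alpha>)) \<subseteq> fst (m \<alpha>)"
    if "sound_round \<kappa> ?Y m (\<Psi> m) \<alpha>" for m \<alpha>
  proof -
    have "openin ?Y (fst (m \<alpha>))" "snd (m \<alpha>) \<in> fst (m \<alpha>)"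
      using that unfolding sound_round_def by blast+
    from small_box_in_open[OF adm this] show ?thesis unfolding box_def by (rule someI_ex)
  qed
  have cur: "x i \<in> current_set \<kappa> (X i) (\<Phi> i (c i m)) \<alpha>"
    if "x \<in> current_set \<kappa> ?Y (\<Psi> m) \<alpha>" "i \<in> I" for x m \<alpha> i
    using that unfolding current_set_def \<Psi>_def top by (auto simp: PiE_iff)
  have sound: "sound_round \<kappa> (X i) (c i m) (\<Phi> i (c i m)) \<alpha>"
    if i: "i \<in> I" and snd: "sound_round \<kappa> ?Y m (\<Psi> m) \<alpha>" for m \<alpha> i
  proof -
    have "round_reached \<kappa> (X i) (\<Phi> i (c i m)) \<alpha>"
      using snd cur[OF _ i] unfolding sound_round_def round_reached_def by blast
    moreover have "openin (X i) (box (m \<alpha>) i)" "snd (m \<alpha>) i \<in> box (m \<alpha>) i"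
      using box[OF snd] i unfolding small_box_def by auto
    moreover have "snd (m \<alpha>) i \<in> current_set \<kappa> (X i) (\<Phi> i (c i m)) \<alpha>"
      using snd cur[OF _ i] unfolding sound_round_def by blast
    ultimately show ?thesis unfolding sound_round_def c_def by simp
  qed
  have "winning_response \<kappa> ?Y \<Psi>"
  proof (rule winning_responseI)
    show "causal \<kappa> \<Psi>"
      unfolding causal_def
    proof (intro allI ballI impI)
      fix m m' :: "'k \<Rightarrow> ('i \<Rightarrow> 'a) set \<times> ('i \<Rightarrow> 'a)" and \<alpha>
      assume \<alpha>: "\<alpha> \<in> Field \<kappa>" and eq: "\<forall>\<beta>\<in>under \<kappa> \<alpha>. m \<beta> = m' \<beta>"
      have "\<Phi> i (c i m) \<alpha> = \<Phi> i (c i m') \<alpha>" if "i \<in> I" for i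
        using eq by (intro causalD[OF winning_response_causal[OF win[OF that]] \<alpha>]) (auto simp: c_def)
      then show "\<Psi> m \<alpha> = \<Psi> m' \<alpha>" unfolding \<Psi>_def by (rule PiE_cong)
    qed
  next
    fix m \<alpha> assume \<alpha>: "\<alpha> \<in> Field \<kappa>" and snd: "\<And>\<beta>. \<beta> \<in> under \<kappa> \<alpha> \<Longrightarrow> sound_round \<kappa> ?Y m (\<Psi> m) \<beta>"
    have self: "\<alpha> \<in> under \<kappa> \<alpha>" using in_under_self[OF wo \<alpha>] .
    have D: "openin (X i) (\<Phi> i (c i m) \<alpha>)" "snd (m \<alpha>) i \<in> \<Phi> i (c i m) \<alpha>"
      "\<Phi> i (c i m) \<alpha> \<inter> current_set \<kappa> (X i) (\<Phi> i (c i m)) \<alpha> \<subseteq> box (m \<alpha>) i" if i: "i \<in> I" for i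
      using winning_responseD[where m = "c i m", OF win[OF i] \<alpha> sound[OF i snd]]
      unfolding c_def[of i m \<alpha>] by simp_all
    have small: "|{i\<in>I. box (m \<beta>) i \<noteq> topspace (X i)}| <o \<kappa>" if "\<beta> \<in> under \<kappa> \<alpha>" for \<beta>
      using box[OF snd[OF that]] unfolding small_box_def by blast
    have "\<Phi> i (c i m) \<alpha> = topspace (X i)"
      if i: "i \<in> I" and "\<And>\<beta>. \<beta> \<in> under \<kappa> \<alpha> \<Longrightarrow> box (m \<beta>) i = topspace (X i)" for i
    proof -
      have "\<forall>\<beta>\<in>under \<kappa> \<alpha>. fst (c i m \<beta>) = topspace (X i)" using that(2) by (simp add: c_def)
      then show ?thesis using pat[OF i] \<alpha> unfolding patient_def by blast
    qed
    then have sub: "{i\<in>I. \<Phi> i (c i m) \<alpha> \<noteq> topspace (X i)} \<subseteq>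
        (\<Union>\<beta>\<in>under \<kappa> \<alpha>. {i\<in>I. box (m \<beta>) i \<noteq> topspace (X i)})"
      by auto
    have "|\<Union>\<beta>\<in>under \<kappa> \<alpha>. {i\<in>I. box (m \<beta>) i \<noteq> topspace (X i)}| <o \<kappa>"
      by (rule admissible_cardinalD(5)[OF adm card_of_under_less[OF card inf \<alpha>]]) (rule small)
    then have "|{i\<in>I. \<Phi> i (c i m) \<alpha> \<noteq> topspace (X i)}| <o \<kappa>"
      by (rule ordLeq_ordLess_trans[OF card_of_mono1[OF sub]])
    then have "openin ?Y (\<Psi> m \<alpha>)"
      using D(1) unfolding \<Psi>_def by (intro openin_small_box) (simp add: small_box_def)
    moreover have "snd (m \<alpha>) \<in> \<Psi> m \<alpha>"
      using D(2) box[OF snd[OF self]] unfolding \<Psi>_def by (auto simp: PiE_iff)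
    moreover have "\<Psi> m \<alpha> \<inter> current_set \<kappa> ?Y (\<Psi> m) \<alpha> \<subseteq> fst (m \<alpha>)"
    proof
      fix y assume y: "y \<in> \<Psi> m \<alpha> \<inter> current_set \<kappa> ?Y (\<Psi> m) \<alpha>"
      then have "y i \<in> box (m \<alpha>) i" if "i \<in> I" for i
        using D(3)[OF that] cur[OF _ that, of y m \<alpha>] that unfolding \<Psi>_def by auto
      then have "y \<in> PiE I (box (m \<alpha>))" using y unfolding \<Psi>_def by (auto simp: PiE_iff)
      then show "y \<in> fst (m \<alpha>)" using box[OF snd[OF self]] by blast
    qed
    ultimately show "openin ?Y (\<Psi> m \<alpha>) \<and> snd (m \<alpha>) \<in> \<Psi> m \<alpha> \<and> \<Psi> m \<alpha> \<inter> current_set \<kappa> ?Y (\<Psi> m) \<alpha> \<subseteq> fst (m \<alpha>)"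
      by blast
  next
    fix m assume snd: "\<And>\<alpha>. \<alpha> \<in> Field \<kappa> \<Longrightarrow> sound_round \<kappa> ?Y m (\<Psi> m) \<alpha>"
    have "\<exists>x\<in>topspace (X i). \<forall>\<alpha>\<in>Field \<kappa>. x \<in> \<Phi> i (c i m) \<alpha>" if i: "i \<in> I" for i
      by (rule winning_response_wins[OF win[OF i]]) (rule sound[OF i snd])
    then obtain x where x: "\<And>i. i \<in> I \<Longrightarrow> x i \<in> topspace (X i) \<and> (\<forall>\<alpha>\<in>Field \<kappa>. x i \<in> \<Phi> i (c i m) \<alpha>)"
      by metis
    then have "restrict x I \<in> topspace ?Y" "\<forall>\<alpha>\<in>Field \<kappa>. restrict x I \<in> \<Psi> m \<alpha>"
      unfolding top \<Psi>_def by auto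
    then show "\<exists>x\<in>topspace ?Y. \<forall>\<alpha>\<in>Field \<kappa>. x \<in> \<Psi> m \<alpha>" by blast
  qed
  then show ?thesis by (intro exI)
qed

section \<open>Weight\<close>

text \<open>By regularity a subset of \<open>\<kappa>\<close> of size less than \<open>\<kappa>\<close> is bounded by some \<open>\<gamma> < \<kappa>\<close>, and so it is determined
  by its characteristic function on \<open>\<gamma>\<close>, a binary sequence of length less than \<open>\<kappa>\<close>. This is where
  \<open>2\<^sup><\<^sup>\<kappa> = \<kappa>\<close> enters.\<close>

lemma small_subsets_of_Field:
  assumes adm: "admissible_cardinal \<kappa>"
  shows "|{A. A \<subseteq> Field \<kappa> \<and> |A| <o \<kappa>}| \<le>o \<kappa>"
proof -
  note card = admissible_cardinalD(1)[OF adm] and wo = admissible_cardinalD(2)[OF adm]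
    and inf = admissible_cardinalD(3)[OF adm]
  define decode :: "('a \<Rightarrow> bool option) \<Rightarrow> 'a set" where "decode s = {\<beta>. s \<beta> = Some True}" for s
  have "{A. A \<subseteq> Field \<kappa> \<and> |A| <o \<kappa>} \<subseteq> decode ` binary_seqs_below \<kappa>"
  proof
    fix A assume "A \<in> {A. A \<subseteq> Field \<kappa> \<and> |A| <o \<kappa>}"
    then have A: "A \<subseteq> Field \<kappa>" "|A| <o \<kappa>" by blast+
    have "\<not> |A| =o \<kappa>" using A(2) not_ordLess_ordIso by blast
    then have "\<not> cofinal A \<kappa>"
      using A(1) adm unfolding admissible_cardinal_def regularCard_def by blast
    then obtain \<alpha> where \<alpha>: "\<alpha> \<in> Field \<kappa>" "\<And>\<beta>. \<beta> \<in> A \<Longrightarrow> \<alpha> = \<beta> \<or> (\<alpha>, \<beta>) \<notin> \<kappa>"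
      unfolding cofinal_def by blast
    obtain \<gamma> where \<gamma>: "\<gamma> \<in> Field \<kappa>" "\<alpha> \<noteq> \<gamma>" "(\<alpha>, \<gamma>) \<in> \<kappa>"
      using infinite_Card_order_limit[OF card inf \<alpha>(1)] by blast
    then have "under \<kappa> \<alpha> \<subseteq> underS \<kappa> \<gamma>" by (intro under_subset_underS[OF wo]) (simp add: underS_def)
    moreover have "\<beta> \<in> under \<kappa> \<alpha>" if "\<beta> \<in> A" for \<beta>
      using underS_or_above[OF wo subsetD[OF A(1) that] \<alpha>(1)] \<alpha>(2)[OF that] in_under_self[OF wo \<alpha>(1)]
        underS_subset_under[of \<kappa> \<alpha>] unfolding above_def by auto
    ultimately have "A \<subseteq> underS \<kappa> \<gamma>" by blast
    define s where "s \<beta> = (if \<beta> \<in> underS \<kappa> \<gamma> then Some (\<beta> \<in> A) else None)" for \<beta>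
    have "dom s = underS \<kappa> \<gamma>" unfolding s_def dom_def by simp
    then have "s \<in> binary_seqs_below \<kappa>" using \<gamma>(1) unfolding binary_seqs_below_def by blast
    moreover have "A = decode s" using \<open>A \<subseteq> underS \<kappa> \<gamma>\<close> unfolding decode_def s_def by auto
    ultimately show "A \<in> decode ` binary_seqs_below \<kappa>" by blast
  qed
  from card_of_mono1[OF this] show ?thesis
    by (rule ordLeq_transitive[OF _ ordLeq_transitive[OF card_of_image admissible_cardinalD(4)[OF adm]]])
qed

lemma small_subsets:
  fixes \<kappa> :: "'k rel" and Z :: "'z set"
  assumes adm: "admissible_cardinal \<kappa>" and Z: "|Z| \<le>o \<kappa>"
  shows "|{A. A \<subseteq> Z \<and> |A| <o \<kappa>}| \<le>o \<kappa>"
proof -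
  have "|Z| \<le>o |Field \<kappa>|"
    using Z card_of_Field_ordIso[OF admissible_cardinalD(1)[OF adm]] ordIso_symmetric ordLeq_ordIso_trans
    by blast
  then obtain e where e: "inj_on e Z" "e ` Z \<subseteq> Field \<kappa>"
    using card_of_ordLeq[of Z "Field \<kappa>"] by blast
  have "inj_on ((`) e) {A. A \<subseteq> Z \<and> |A| <o \<kappa>}"
    using inj_on_image_Pow[OF e(1)] by (rule inj_on_subset) blast
  moreover have "(`) e ` {A. A \<subseteq> Z \<and> |A| <o \<kappa>} \<subseteq> {A. A \<subseteq> Field \<kappa> \<and> |A| <o \<kappa>}"
    using e(2) ordLeq_ordLess_trans[OF card_of_image] by blast
  ultimately have "|{A. A \<subseteq> Z \<and> |A| <o \<kappa>}| \<le>o |{A. A \<subseteq> Field \<kappa> \<and> |A| <o \<kappa>}|"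
    using card_of_ordLeq by blast
  then show ?thesis using small_subsets_of_Field[OF adm] ordLeq_transitive by blast
qed

lemma weight_leI:
  assumes "|\<B>| \<le>o \<kappa>" "\<forall>B\<in>\<B>. openin X B"
    and "\<And>U x. openin X U \<Longrightarrow> x \<in> U \<Longrightarrow> \<exists>B\<in>\<B>. x \<in> B \<and> B \<subseteq> U"
  shows "weight_le X \<kappa>"
  unfolding weight_le_def using assms by (intro exI[of _ \<B>]) simp

lemma weight_le_subtopology:
  assumes "weight_le X \<kappa>"
  shows "weight_le (subtopology X S) \<kappa>"
proof -
  obtain \<B> where \<B>: "|\<B>| \<le>o \<kappa>" "\<forall>B\<in>\<B>. openin X B"
    "\<forall>U x. openin X U \<and> x \<in> U \<longrightarrow> (\<exists>B\<in>\<B>. x \<in> B \<and> B \<subseteq> U)"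
    using assms unfolding weight_le_def by blast
  let ?\<C> = "(\<lambda>B. B \<inter> S) ` \<B>"
  have "|?\<C>| \<le>o \<kappa>" using card_of_image \<B>(1) ordLeq_transitive by blast
  moreover have "\<forall>C\<in>?\<C>. openin (subtopology X S) C"
    using \<B>(2) unfolding openin_subtopology by blast
  moreover have "\<exists>C\<in>?\<C>. x \<in> C \<and> C \<subseteq> U" if U: "openin (subtopology X S) U" "x \<in> U" for U x
  proof -
    obtain T where T: "openin X T" "U = T \<inter> S" using U(1) unfolding openin_subtopology by blast
    then have "openin X T \<and> x \<in> T" using U(2) by blast
    with \<B>(3) obtain B where "B \<in> \<B>" "x \<in> B" "B \<subseteq> T" by metis
    then show ?thesis using T(2) U(2) by (intro bexI[of _ "B \<inter> S"]) auto
  qed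
  ultimately show ?thesis by (rule weight_leI)
qed

lemma weight_bases:
  assumes "\<And>i. i \<in> I \<Longrightarrow> weight_le (X i) \<kappa>"
  shows "\<exists>\<B>. \<forall>i\<in>I. |\<B> i| \<le>o \<kappa> \<and> (\<forall>B\<in>\<B> i. openin (X i) B) \<and>
    (\<forall>U x. openin (X i) U \<and> x \<in> U \<longrightarrow> (\<exists>B\<in>\<B> i. x \<in> B \<and> B \<subseteq> U))"
  by (rule bchoice) (use assms in \<open>simp add: weight_le_def\<close>)

lemma openin_sum_summand:
  assumes "i \<in> I" "openin (X i) U"
  shows "openin (sum_topology X I) ({i} \<times> U)"
proof -
  have "openin (X j) {x. (j, x) \<in> {i} \<times> U}" for j using assms(2) by (cases "j = i") simp_all
  then show ?thesis using openin_subset[OF assms(2)] assms(1) unfolding openin_sum_topology by auto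
qed

lemma weight_le_sum:
  assumes card: "Card_order \<kappa>" and inf: "infinite (Field \<kappa>)" and I: "|I| \<le>o \<kappa>"
    and weight: "\<And>i. i \<in> I \<Longrightarrow> weight_le (X i) \<kappa>"
  shows "weight_le (sum_topology X I) \<kappa>"
proof -
  have "\<exists>\<B>. \<forall>i\<in>I. |\<B> i| \<le>o \<kappa> \<and> (\<forall>B\<in>\<B> i. openin (X i) B) \<and>
    (\<forall>U x. openin (X i) U \<and> x \<in> U \<longrightarrow> (\<exists>B\<in>\<B> i. x \<in> B \<and> B \<subseteq> U))"
    by (rule weight_bases) (rule weight)
  then obtain \<B> where *: "\<forall>i\<in>I. |\<B> i| \<le>o \<kappa> \<and> (\<forall>B\<in>\<B> i. openin (X i) B) \<and>
    (\<forall>U x. openin (X i) U \<and> x \<in> U \<longrightarrow> (\<exists>B\<in>\<B> i. x \<in> B \<and> B \<subseteq> U))" ..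
  have \<B>: "\<And>i. i \<in> I \<Longrightarrow> |\<B> i| \<le>o \<kappa>" "\<And>i B. i \<in> I \<Longrightarrow> B \<in> \<B> i \<Longrightarrow> openin (X i) B"
    "\<And>i U x. i \<in> I \<Longrightarrow> openin (X i) U \<Longrightarrow> x \<in> U \<Longrightarrow> \<exists>B\<in>\<B> i. x \<in> B \<and> B \<subseteq> U"
    using * by simp_all
  let ?\<C> = "(\<lambda>(i, B). {i} \<times> B) ` Sigma I \<B>"
  have "|Sigma I \<B>| \<le>o \<kappa>" using \<B>(1) by (intro card_of_Sigma_ordLeq_infinite_Field[OF inf card I]) blast
  then have "|?\<C>| \<le>o \<kappa>" using card_of_image ordLeq_transitive by blast
  moreover have "\<forall>C\<in>?\<C>. openin (sum_topology X I) C"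
    using openin_sum_summand \<B>(2) by fast
  moreover have "\<exists>C\<in>?\<C>. p \<in> C \<and> C \<subseteq> U" if U: "openin (sum_topology X I) U" "p \<in> U" for U p
  proof -
    obtain i x where p: "p = (i, x)" by (cases p)
    have i: "i \<in> I" "openin (X i) {x. (i, x) \<in> U}" using U p unfolding openin_sum_topology by auto
    obtain B where "B \<in> \<B> i" "x \<in> B" "B \<subseteq> {x. (i, x) \<in> U}"
      using \<B>(3)[OF i] U(2) p by blast
    then show ?thesis using i(1) p by (intro bexI[of _ "{i} \<times> B"]) auto
  qed
  ultimately show ?thesis by (rule weight_leI)
qed

text \<open>A base is given by the boxes that restrict fewer than \<open>\<kappa>\<close> coordinates, each to a basic open set. They
  are coded by small subsets of the disjoint sum of the bases of the factors, a set of size at most \<open>\<kappa>\<close>.\<close>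

lemma weight_le_product:
  fixes \<kappa> :: "'k rel" and X :: "'i \<Rightarrow> 'a topology"
  assumes adm: "admissible_cardinal \<kappa>" and I: "|I| \<le>o \<kappa>"
    and weight: "\<And>i. i \<in> I \<Longrightarrow> weight_le (X i) \<kappa>"
  shows "weight_le (lt_supported_product_topology \<kappa> X I) \<kappa>"
proof -
  let ?Y = "lt_supported_product_topology \<kappa> X I"
  note card = admissible_cardinalD(1)[OF adm] and inf = admissible_cardinalD(3)[OF adm]
  have "\<exists>\<B>. \<forall>i\<in>I. |\<B> i| \<le>o \<kappa> \<and> (\<forall>B\<in>\<B> i. openin (X i) B) \<and>
    (\<forall>U x. openin (X i) U \<and> x \<in> U \<longrightarrow> (\<exists>B\<in>\<B> i. x \<in> B \<and> B \<subseteq> U))"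
    by (rule weight_bases) (rule weight)
  then obtain \<B> where *: "\<forall>i\<in>I. |\<B> i| \<le>o \<kappa> \<and> (\<forall>B\<in>\<B> i. openin (X i) B) \<and>
    (\<forall>U x. openin (X i) U \<and> x \<in> U \<longrightarrow> (\<exists>B\<in>\<B> i. x \<in> B \<and> B \<subseteq> U))" ..
  have \<B>: "\<And>i. i \<in> I \<Longrightarrow> |\<B> i| \<le>o \<kappa>" "\<And>i B. i \<in> I \<Longrightarrow> B \<in> \<B> i \<Longrightarrow> openin (X i) B"
    "\<And>i U x. i \<in> I \<Longrightarrow> openin (X i) U \<Longrightarrow> x \<in> U \<Longrightarrow> \<exists>B\<in>\<B> i. x \<in> B \<and> B \<subseteq> U"
    using * by simp_all
  define box where "box A = PiE I (\<lambda>i. topspace (X i) \<inter> (\<Inter>B\<in>{B. (i, B) \<in> A}. B))" for A :: "('i \<times> 'a set) set"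
  let ?\<A> = "{A. A \<subseteq> Sigma I \<B> \<and> |A| <o \<kappa>}"
  \<comment> \<open>A small set may contain infinitely many basic sets for one coordinate, and then its box need not
    be open; such codes are discarded.\<close>
  define \<C> where "\<C> = {C \<in> box ` ?\<A>. openin ?Y C}"
  have "|Sigma I \<B>| \<le>o \<kappa>" using \<B>(1) by (intro card_of_Sigma_ordLeq_infinite_Field[OF inf card I]) blast
  then have "|?\<A>| \<le>o \<kappa>" by (rule small_subsets[OF adm])
  then have "|box ` ?\<A>| \<le>o \<kappa>" using card_of_image ordLeq_transitive by blast
  moreover have "|\<C>| \<le>o |box ` ?\<A>|" unfolding \<C>_def by (rule card_of_mono1) blast
  ultimately have "|\<C>| \<le>o \<kappa>" using ordLeq_transitive by blast
  moreover have "\<forall>C\<in>\<C>. openin ?Y C" unfolding \<C>_def by blast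
  moreover have "\<exists>C\<in>\<C>. x \<in> C \<and> C \<subseteq> W" if W: "openin ?Y W" "x \<in> W" for W x
  proof -
    obtain U where U: "small_box \<kappa> X I U" "x \<in> PiE I U" "PiE I U \<subseteq> W"
      using small_box_in_open[OF adm W] by blast
    define s where "s = {i\<in>I. U i \<noteq> topspace (X i)}"
    have s: "|s| <o \<kappa>" "s \<subseteq> I" using U(1) unfolding s_def small_box_def by auto
    have "\<forall>i\<in>s. \<exists>B\<in>\<B> i. x i \<in> B \<and> B \<subseteq> U i"
    proof
      fix i assume "i \<in> s"
      then have i: "i \<in> I" using s(2) by blast
      have "openin (X i) (U i)" "x i \<in> U i" using U(1,2) i unfolding small_box_def by auto
      then show "\<exists>B\<in>\<B> i. x i \<in> B \<and> B \<subseteq> U i" by (rule \<B>(3)[OF i])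
    qed
    from bchoice[OF this[unfolded Bex_def]]
    obtain B where B: "\<And>i. i \<in> s \<Longrightarrow> B i \<in> \<B> i \<and> x i \<in> B i \<and> B i \<subseteq> U i" by blast
    let ?A = "(\<lambda>i. (i, B i)) ` s"
    let ?V = "\<lambda>i. if i \<in> s then B i else topspace (X i)"
    have "?A \<in> ?\<A>" using B s(2) ordLeq_ordLess_trans[OF card_of_image s(1)] by auto
    have open_B: "openin (X i) (B i)" if "i \<in> s" for i using \<B>(2) B that s(2) by blast
    have "topspace (X i) \<inter> (\<Inter>C\<in>{C. (i, C) \<in> ?A}. C) = ?V i" for i
      using openin_subset[OF open_B] by auto
    then have box: "box ?A = PiE I ?V" unfolding box_def by simp
    have "|{i\<in>I. ?V i \<noteq> topspace (X i)}| \<le>o |s|" by (rule card_of_mono1) auto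
    then have "|{i\<in>I. ?V i \<noteq> topspace (X i)}| <o \<kappa>" using s(1) by (rule ordLeq_ordLess_trans)
    moreover have "\<forall>i\<in>I. openin (X i) (?V i)" using open_B by simp
    ultimately have "small_box \<kappa> X I ?V" unfolding small_box_def by blast
    then have "openin ?Y (box ?A)" unfolding box by (rule openin_small_box)
    then have "box ?A \<in> \<C>" using \<open>?A \<in> ?\<A>\<close> unfolding \<C>_def by blast
    moreover have "?V i \<subseteq> U i" if "i \<in> I" for i using B that unfolding s_def by auto
    then have "PiE I ?V \<subseteq> PiE I U" by (rule PiE_mono)
    then have "PiE I ?V \<subseteq> W" using U(3) by blast
    moreover have "x \<in> PiE I ?V"
    proof -
      have "x i \<in> ?V i" if "i \<in> I" for i using B[of i] U(2) that unfolding s_def by auto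
      then show ?thesis using U(2) by (auto simp: PiE_iff)
    qed
    ultimately show ?thesis unfolding box[symmetric] by blast
  qed
  ultimately show ?thesis by (rule weight_leI)
qed

section \<open>Separation axioms\<close>

lemma openin_cylinder:
  assumes adm: "admissible_cardinal \<kappa>" and i: "i \<in> I" and U: "openin (X i) U"
  shows "openin (lt_supported_product_topology \<kappa> X I) {x \<in> PiE I (\<lambda>i. topspace (X i)). x i \<in> U}"
proof -
  let ?V = "\<lambda>j. if j = i then U else topspace (X j)"
  have "finite {j\<in>I. ?V j \<noteq> topspace (X j)}" by (rule finite_subset[of _ "{i}"]) auto
  then have "|{j\<in>I. ?V j \<noteq> topspace (X j)}| <o \<kappa>"
    by (rule finite_card_less[OF admissible_cardinalD(1,3)[OF adm]])
  moreover have "\<forall>j\<in>I. openin (X j) (?V j)" using U by simp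
  ultimately have "small_box \<kappa> X I ?V" unfolding small_box_def by blast
  moreover have "(\<forall>j\<in>I. x j \<in> ?V j) \<longleftrightarrow> (\<forall>j\<in>I. x j \<in> topspace (X j)) \<and> x i \<in> U" for x
    using i openin_subset[OF U] by (metis subsetD)
  then have "{x \<in> PiE I (\<lambda>i. topspace (X i)). x i \<in> U} = PiE I ?V"
    unfolding set_eq_iff mem_Collect_eq PiE_iff by blast
  ultimately show ?thesis using openin_small_box by metis
qed

lemma Hausdorff_product:
  assumes adm: "admissible_cardinal \<kappa>" and haus: "\<And>i. i \<in> I \<Longrightarrow> Hausdorff_space (X i)"
  shows "Hausdorff_space (lt_supported_product_topology \<kappa> X I)"
  unfolding Hausdorff_space_def topspace_lt_supported_product[OF adm]
proof (intro allI impI)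
  fix x y assume xy: "x \<in> PiE I (\<lambda>i. topspace (X i)) \<and> y \<in> PiE I (\<lambda>i. topspace (X i)) \<and> x \<noteq> y"
  then have "\<not> (\<forall>i\<in>I. x i = y i)" using PiE_ext[of x I _ y] by blast
  then obtain i where i: "i \<in> I" "x i \<noteq> y i" by blast
  moreover have "x i \<in> topspace (X i)" "y i \<in> topspace (X i)" using xy i(1) by auto
  ultimately obtain U V where UV: "openin (X i) U" "openin (X i) V" "x i \<in> U" "y i \<in> V" "disjnt U V"
    using haus[OF i(1)] unfolding Hausdorff_space_def by metis
  let ?c = "\<lambda>U. {x \<in> PiE I (\<lambda>i. topspace (X i)). x i \<in> U}"
  have "x \<in> ?c U" "y \<in> ?c V" "disjnt (?c U) (?c V)"
    using UV(3-5) xy unfolding disjnt_def by blast+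
  then show "\<exists>U V. openin (lt_supported_product_topology \<kappa> X I) U \<and>
      openin (lt_supported_product_topology \<kappa> X I) V \<and> x \<in> U \<and> y \<in> V \<and> disjnt U V"
    using openin_cylinder[where X = X, OF adm i(1) UV(1)] openin_cylinder[where X = X, OF adm i(1) UV(2)] by blast
qed

text \<open>The form of regularity that is convenient for spaces given by a base.\<close>

lemma regular_space_closed_neighbourhood:
  "regular_space X \<longleftrightarrow> (\<forall>W x. openin X W \<and> x \<in> W \<longrightarrow>
     (\<exists>U C. openin X U \<and> closedin X C \<and> x \<in> U \<and> U \<subseteq> C \<and> C \<subseteq> W))"
  unfolding neighbourhood_base_of_closedin[symmetric] neighbourhood_base_of by blast

lemma regular_product:
  assumes adm: "admissible_cardinal \<kappa>" and reg: "\<And>i. i \<in> I \<Longrightarrow> regular_space (X i)"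
  shows "regular_space (lt_supported_product_topology \<kappa> X I)"
  unfolding regular_space_closed_neighbourhood
proof (intro allI impI)
  let ?Y = "lt_supported_product_topology \<kappa> X I"
  fix W x assume "openin ?Y W \<and> x \<in> W"
  then obtain U where U: "small_box \<kappa> X I U" "x \<in> PiE I U" "PiE I U \<subseteq> W"
    using small_box_in_open[OF adm] by metis
  \<comment> \<open>Where the box is the whole factor, the smaller neighbourhood \<open>V\<close> has to be the whole factor as well,
    so that the smaller box again has small support.\<close>
  define good where "good i V C \<longleftrightarrow> openin (X i) V \<and> closedin (X i) C \<and> x i \<in> V \<and> V \<subseteq> C \<and> C \<subseteq> U i \<and>
      (U i = topspace (X i) \<longrightarrow> V = topspace (X i))" for i V C
  have "\<forall>i\<in>I. \<exists>p. good i (fst p) (snd p)"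
  proof
    fix i assume i: "i \<in> I"
    have o: "openin (X i) (U i)" "x i \<in> U i" using U(1,2) i unfolding small_box_def by auto
    show "\<exists>p. good i (fst p) (snd p)"
    proof (cases "U i = topspace (X i)")
      case True
      then have "good i (U i) (U i)" using o unfolding good_def by simp
      then show ?thesis by (intro exI[of _ "(U i, U i)"]) simp
    next
      case False
      obtain V C where "openin (X i) V" "closedin (X i) C" "x i \<in> V" "V \<subseteq> C" "C \<subseteq> U i"
        using reg[OF i] o unfolding regular_space_closed_neighbourhood by metis
      then have "good i V C" using False unfolding good_def by blast
      then show ?thesis by (intro exI[of _ "(V, C)"]) simp
    qed
  qed
  from bchoice[OF this] obtain p where p: "\<And>i. i \<in> I \<Longrightarrow> good i (fst (p i)) (snd (p i))" by blast
  let ?V = "\<lambda>i. fst (p i)" and ?C = "\<lambda>i. snd (p i)"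
  have "|{i\<in>I. ?V i \<noteq> topspace (X i)}| \<le>o |{i\<in>I. U i \<noteq> topspace (X i)}|"
    using p unfolding good_def by (intro card_of_mono1) blast
  then have "|{i\<in>I. ?V i \<noteq> topspace (X i)}| <o \<kappa>"
    by (rule ordLeq_ordLess_trans) (use U(1) in \<open>simp add: small_box_def\<close>)
  then have "openin ?Y (PiE I ?V)"
    using p by (intro openin_small_box) (simp add: small_box_def good_def)
  moreover have "closedin ?Y (PiE I ?C)"
  proof -
    let ?c = "\<lambda>i. {x \<in> PiE I (\<lambda>i. topspace (X i)). x i \<in> topspace (X i) - ?C i}"
    have "openin ?Y (?c i)" if "i \<in> I" for i
      using p[OF that] by (intro openin_cylinder[where X = X, OF adm that]) (simp add: good_def closedin_def)
    then have "openin ?Y (\<Union>i\<in>I. ?c i)" by blast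
    moreover have "?C i \<subseteq> topspace (X i)" if "i \<in> I" for i
      using p[OF that] closedin_subset unfolding good_def by blast
    then have "PiE I ?C \<subseteq> PiE I (\<lambda>i. topspace (X i))" by (rule PiE_mono)
    moreover have "PiE I (\<lambda>i. topspace (X i)) - PiE I ?C = (\<Union>i\<in>I. ?c i)"
      unfolding set_eq_iff Diff_iff UN_iff mem_Collect_eq PiE_iff by blast
    ultimately show ?thesis unfolding closedin_def topspace_lt_supported_product[OF adm] by simp
  qed
  moreover have "x \<in> PiE I ?V" using p U(2) unfolding good_def by (auto simp: PiE_iff)
  moreover have "PiE I ?V \<subseteq> PiE I ?C" "PiE I ?C \<subseteq> PiE I U"
    using p unfolding good_def by (auto intro!: PiE_mono)
  ultimately show "\<exists>V C. openin ?Y V \<and> closedin ?Y C \<and> x \<in> V \<and> V \<subseteq> C \<and> C \<subseteq> W"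
    using U(3) by (intro exI[of _ "PiE I ?V"] exI[of _ "PiE I ?C"]) simp
qed

lemma closedin_sum_summand:
  assumes "i \<in> I" "closedin (X i) C"
  shows "closedin (sum_topology X I) ({i} \<times> C)"
proof -
  have "closedin (X j) {x. (j, x) \<in> {i} \<times> C}" for j using assms(2) by (cases "j = i") simp_all
  then show ?thesis using closedin_subset[OF assms(2)] assms(1) unfolding closedin_sum_topology by auto
qed

lemma regular_sum:
  assumes reg: "\<And>i. i \<in> I \<Longrightarrow> regular_space (X i)"
  shows "regular_space (sum_topology X I)"
  unfolding regular_space_closed_neighbourhood
proof (intro allI impI)
  fix W p assume W: "openin (sum_topology X I) W \<and> p \<in> W"
  obtain i x where p: "p = (i, x)" by (cases p)
  have i: "i \<in> I" "openin (X i) {x. (i, x) \<in> W}" "x \<in> {x. (i, x) \<in> W}"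
    using W p unfolding openin_sum_topology by auto
  obtain U C where UC: "openin (X i) U" "closedin (X i) C" "x \<in> U" "U \<subseteq> C" "C \<subseteq> {x. (i, x) \<in> W}"
    using reg[OF i(1)] i(2,3) unfolding regular_space_closed_neighbourhood by metis
  have "p \<in> {i} \<times> U" "{i} \<times> U \<subseteq> {i} \<times> C" "{i} \<times> C \<subseteq> W" using UC p by auto
  then show "\<exists>U C. openin (sum_topology X I) U \<and> closedin (sum_topology X I) C \<and> p \<in> U \<and> U \<subseteq> C \<and> C \<subseteq> W"
    using openin_sum_summand[of i I X, OF i(1) UC(1)] closedin_sum_summand[of i I X, OF i(1) UC(2)] by blast
qed

lemma Hausdorff_sum:
  assumes haus: "\<And>i. i \<in> I \<Longrightarrow> Hausdorff_space (X i)"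
  shows "Hausdorff_space (sum_topology X I)"
  unfolding Hausdorff_space_def topspace_sum_topology
proof (intro allI impI)
  fix p q assume pq: "p \<in> Sigma I (topspace \<circ> X) \<and> q \<in> Sigma I (topspace \<circ> X) \<and> p \<noteq> q"
  obtain i x j y where ij: "p = (i, x)" "q = (j, y)" by (cases p, cases q)
  then have mem: "i \<in> I" "x \<in> topspace (X i)" "j \<in> I" "y \<in> topspace (X j)" using pq by auto
  obtain U V where UV: "openin (X i) U" "openin (X j) V" "x \<in> U" "y \<in> V" "i = j \<Longrightarrow> disjnt U V"
  proof (cases "i = j")
    case True
    then have "x \<noteq> y" using pq ij by simp
    then show thesis
      using haus[OF mem(1)] mem True that unfolding Hausdorff_space_def by metis
  next
    case False
    then show thesis using that mem by blast
  qed
  have "p \<in> {i} \<times> U" "q \<in> {j} \<times> V" "disjnt ({i} \<times> U) ({j} \<times> V)"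
    using UV(3-5) ij unfolding disjnt_def by auto
  then show "\<exists>U V. openin (sum_topology X I) U \<and> openin (sum_topology X I) V \<and> p \<in> U \<and> q \<in> V \<and> disjnt U V"
    using openin_sum_summand[of i I X, OF mem(1) UV(1)] openin_sum_summand[of j I X, OF mem(3) UV(2)] by blast
qed

section \<open>Closure of the class of spaces\<close>

lemma fSC_space_iff:
  assumes "admissible_cardinal \<kappa>"
  shows "fSC_space \<kappa> X \<longleftrightarrow>
    regular_space X \<and> Hausdorff_space X \<and> weight_le X \<kappa> \<and> (\<exists>\<Phi>. winning_response \<kappa> X \<Phi>)"
proof -
  have "Field \<kappa> \<noteq> {}" using admissible_cardinalD(3)[OF assms] by auto
  then show ?thesis
    using winning_response_of_strategy[OF admissible_cardinalD(2)[OF assms]]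
      strategy_of_winning_response[OF admissible_cardinalD(2)[OF assms]]
    unfolding fSC_space_def by metis
qed

lemma fSC_space_Gdelta:
  assumes adm: "admissible_cardinal \<kappa>" and "fSC_space \<kappa> X" "Gdelta_set \<kappa> X S"
  shows "fSC_space \<kappa> (subtopology X S)"
  using assms(2,3) winning_response_Gdelta[OF admissible_cardinalD(2)[OF adm]]
  unfolding fSC_space_iff[OF adm]
  by (metis regular_space_subtopology Hausdorff_space_subtopology weight_le_subtopology)

lemma fSC_space_sum:
  assumes adm: "admissible_cardinal \<kappa>" and I: "|I| \<le>o \<kappa>" and X: "\<And>i. i \<in> I \<Longrightarrow> fSC_space \<kappa> (X i)"
  shows "fSC_space \<kappa> (sum_topology X I)"
proof -
  note X = X[unfolded fSC_space_iff[OF adm]]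
  have ne: "Field \<kappa> \<noteq> {}" using admissible_cardinalD(3)[OF adm] by auto
  have "\<forall>i\<in>I. \<exists>\<Phi>. winning_response \<kappa> (X i) \<Phi>" using X by blast
  from bchoice[OF this] obtain \<Phi> where \<Phi>: "\<And>i. i \<in> I \<Longrightarrow> winning_response \<kappa> (X i) (\<Phi> i)" by blast
  show ?thesis
    unfolding fSC_space_iff[OF adm]
    using X regular_sum[of I X] Hausdorff_sum[of I X] winning_response_sum[OF admissible_cardinalD(2)[OF adm] ne \<Phi>]
      weight_le_sum[OF admissible_cardinalD(1,3)[OF adm] I, of X] by simp
qed

lemma fSC_space_product:
  assumes adm: "admissible_cardinal \<kappa>" and I: "|I| \<le>o \<kappa>" and X: "\<And>i. i \<in> I \<Longrightarrow> fSC_space \<kappa> (X i)"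
  shows "fSC_space \<kappa> (lt_supported_product_topology \<kappa> X I)"
proof -
  note X = X[unfolded fSC_space_iff[OF adm]]
  have "\<forall>i\<in>I. \<exists>\<Phi>. winning_response \<kappa> (X i) \<Phi> \<and> patient \<kappa> (X i) \<Phi>"
    using X patient_winning_response[OF admissible_cardinalD(1,3)[OF adm]] by blast
  from bchoice[OF this] obtain \<Phi> where
    \<Phi>: "\<And>i. i \<in> I \<Longrightarrow> winning_response \<kappa> (X i) (\<Phi> i)" "\<And>i. i \<in> I \<Longrightarrow> patient \<kappa> (X i) (\<Phi> i)" by blast
  show ?thesis
    unfolding fSC_space_iff[OF adm]
    using X regular_product[OF adm, of I X] Hausdorff_product[OF adm, of I X]
      winning_response_product[OF adm \<Phi>] weight_le_product[OF adm I, of X] by simp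
qed

theorem theorem5p1:
  fixes \<kappa> :: "'k rel"
  assumes "admissible_cardinal \<kappa>"
  shows "(\<forall>(X :: 'a topology) S. fSC_space \<kappa> X \<and> Gdelta_set \<kappa> X S \<longrightarrow> fSC_space \<kappa> (subtopology X S)) \<and>
         (\<forall>(X :: 'i \<Rightarrow> 'a topology) I. |I| \<le>o \<kappa> \<and> (\<forall>i\<in>I. fSC_space \<kappa> (X i)) \<longrightarrow>
            fSC_space \<kappa> (sum_topology X I)) \<and>
         (\<forall>(X :: 'i \<Rightarrow> 'a topology) I. |I| \<le>o \<kappa> \<and> (\<forall>i\<in>I. fSC_space \<kappa> (X i)) \<longrightarrow>
            fSC_space \<kappa> (lt_supported_product_topology \<kappa> X I))"
  using fSC_space_Gdelta[OF assms] fSC_space_sum[OF assms] fSC_space_product[OF assms] by blast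

end
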